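(* Let $G$ be a finite group of composite order, and let $p$ be a prime dividing $|G|$ such that $G$ has a normal cyclic Sylow $p$-subgroup. Let $\mathcal{A}$ be a central S-ring over $G$ which is nontrivial (i.e. $\mathcal{A}\neq \mathbb{Z}e+\mathbb{Z}\underline{G}$). Then $\mathcal{A}$ is imprimitive.
   Context: For a finite group $G$ with identity $e$ and $X\subseteq G$, write $\underline{X}=\sum_{x\in X}x\in\mathbb{Z}G$. A subring $\mathcal{A}$ of $\mathbb{Z}G$ is an S-ring over $G$ if there is a partition $\mathcal{S}(\mathcal{A})$ of $G$ (whose members are called basic sets) such that $\{e\}\in\mathcal{S}(\mathcal{A})$, $X\in\mathcal{S}(\mathcal{A})\Rightarrow X^{-1}\in\mathcal{S}(\mathcal{A})$, and $\mathcal{A}$ is the $\mathbb{Z}$-span of $\{\underline{X}: X\in\mathcal{S}(\mathcal{A})\}$. An $\mathcal{A}$-set is a union of basic sets; an $\mathcal{A}$-subgroup is a subgroup of $G$ that is an $\mathcal{A}$-set. $\mathcal{A}$ is primitive if its only $\mathcal{A}$-subgroups are $\{e\}$ and $G$, and imprimitive otherwise. $\mathcal{A}$ is central if $\mathcal{A}\subseteq\mathcal{Z}(\mathbb{Z}G)$. The trivial S-ring over $G$ is $\mathbb{Z}e+\mathbb{Z}\underline{G}$ (basic sets $\{e\}$ and $G\setminus\{e\}$). *)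

theory Defs
  imports "HOL-Algebra.Algebra"
begin

text \<open>Group ring ZG of a finite group G: integer-valued functions on carrier G
  (zero outside the carrier); an element f stands for the formal sum of f x times x.\<close>

definition group_ring :: "('a, 'b) monoid_scheme \<Rightarrow> ('a \<Rightarrow> int) set" where
  "group_ring G = {f. \<forall>x. x \<notin> carrier G \<longrightarrow> f x = 0}"

definition gr_mult :: "('a, 'b) monoid_scheme \<Rightarrow> ('a \<Rightarrow> int) \<Rightarrow> ('a \<Rightarrow> int) \<Rightarrow> ('a \<Rightarrow> int)" where
  "gr_mult G f g = (\<lambda>x. if x \<in> carrier G
      then (\<Sum>y\<in>carrier G. f y * g (monoid.mult G (m_inv G y) x)) else 0)"

definition uline :: "'a set \<Rightarrow> ('a \<Rightarrow> int)" where
  "uline B = (\<lambda>x. if x \<in> B then 1 else 0)"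

definition zspan :: "'a set set \<Rightarrow> ('a \<Rightarrow> int) set" where
  "zspan S = {f. \<exists>c :: 'a set \<Rightarrow> int. f = (\<lambda>x. \<Sum>B\<in>S. c B * uline B x)}"

definition is_schur_partition :: "('a, 'b) monoid_scheme \<Rightarrow> 'a set set \<Rightarrow> bool" where
  "is_schur_partition G S \<longleftrightarrow>
     {} \<notin> S \<and> \<Union>S = carrier G \<and> (\<forall>B\<in>S. \<forall>Y\<in>S. B \<noteq> Y \<longrightarrow> B \<inter> Y = {}) \<and>
     {one G} \<in> S \<and>
     (\<forall>B\<in>S. m_inv G ` B \<in> S) \<and>
     (\<forall>f\<in>zspan S. \<forall>g\<in>zspan S. gr_mult G f g \<in> zspan S)"

definition is_schur_ring :: "('a, 'b) monoid_scheme \<Rightarrow> ('a \<Rightarrow> int) set \<Rightarrow> bool" where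
  "is_schur_ring G A \<longleftrightarrow> (\<exists>S. is_schur_partition G S \<and> A = zspan S)"

text \<open>Basic sets of an S-ring A: the S with A = zspan S (unique for S-rings).\<close>
definition basic_sets :: "('a, 'b) monoid_scheme \<Rightarrow> ('a \<Rightarrow> int) set \<Rightarrow> 'a set set" where
  "basic_sets G A = (THE S. is_schur_partition G S \<and> A = zspan S)"

definition A_set :: "('a, 'b) monoid_scheme \<Rightarrow> ('a \<Rightarrow> int) set \<Rightarrow> 'a set \<Rightarrow> bool" where
  "A_set G A B \<longleftrightarrow> (\<exists>T \<subseteq> basic_sets G A. B = \<Union>T)"

definition A_subgroup :: "('a, 'b) monoid_scheme \<Rightarrow> ('a \<Rightarrow> int) set \<Rightarrow> 'a set \<Rightarrow> bool" where
  "A_subgroup G A H \<longleftrightarrow> subgroup H G \<and> A_set G A H"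

definition primitive_sring :: "('a, 'b) monoid_scheme \<Rightarrow> ('a \<Rightarrow> int) set \<Rightarrow> bool" where
  "primitive_sring G A \<longleftrightarrow> (\<forall>H. A_subgroup G A H \<longrightarrow> H = {one G} \<or> H = carrier G)"

definition central_sring :: "('a, 'b) monoid_scheme \<Rightarrow> ('a \<Rightarrow> int) set \<Rightarrow> bool" where
  "central_sring G A \<longleftrightarrow> (\<forall>f\<in>A. \<forall>g\<in>group_ring G. gr_mult G f g = gr_mult G g f)"

definition trivial_sring :: "('a, 'b) monoid_scheme \<Rightarrow> ('a \<Rightarrow> int) set" where
  "trivial_sring G = {f. \<exists>a b :: int. f = (\<lambda>x. a * uline {one G} x + b * uline (carrier G) x)}"

end

theory Submission
  imports Defs "HOL-Number_Theory.Cong"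
begin

text \<open>Suppose the S-ring is primitive. Let \<open>P\<close> be the cyclic Sylow subgroup, \<open>P\<^sub>0\<close> its subgroup of order \<open>p\<close>
  (the socle) and \<open>N = C\<^sub>G(P)\<close>. Every basic set is conjugation invariant, so outside \<open>N\<close> it is a union of
  \<open>P\<^sub>0\<close>-cosets, because there \<open>yP\<^sub>0\<close> consists of conjugates of \<open>y\<close>. Inside \<open>N\<close> one uses the \<open>p\<close>-th power
  \<open>D\<^sup>p\<close> of a basic set \<open>D\<close> modulo \<open>p\<close>: its coefficient is \<open>|D \<inter> P\<^sub>0x|\<close> at \<open>x\<^sup>p\<close> for \<open>x \<in> N\<close>, and \<open>0\<close> at all other points.
  The support modulo \<open>p\<close> is an A-set inside a proper subgroup (\<open>N\<close>, or the kernel of the transfer to \<open>P/P\<^sup>p\<close>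
  when \<open>N = G\<close>), hence is contained in the trivial subgroup. Therefore \<open>D - P\<^sub>0\<close> is a union of \<open>P\<^sub>0\<close>-cosets.
  Primitivity now forces \<open>D\<close> to meet \<open>P\<^sub>0\<close> and not to be contained in it, and comparing the coefficients of
  \<open>D D\<inverse>\<close> modulo \<open>p\<close> at points of \<open>D \<inter> P\<^sub>0\<close> and of \<open>D - P\<^sub>0\<close> gives \<open>|D \<inter> P\<^sub>0| \<ge> p/2\<close>. As two
  nontrivial basic sets share only \<open>p - 1\<close> elements of \<open>P\<^sub>0\<close>, there is only one.\<close>

section \<open>The group ring\<close>

context group
begin

lemma mult_inv_cancel [simp]:
  assumes "x \<in> carrier G" "y \<in> carrier G"
  shows "inv x \<otimes> (x \<otimes> y) = y" "x \<otimes> (inv x \<otimes> y) = y"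
  using assms by (simp_all add: m_assoc[symmetric])

definition gr_pow :: "('a \<Rightarrow> int) \<Rightarrow> nat \<Rightarrow> 'a \<Rightarrow> int" where
  "gr_pow f n = ((gr_mult G f) ^^ n) (uline {\<one>})"

lemma gr_pow_simps [simp]:
  "gr_pow f 0 = uline {\<one>}" "gr_pow f (Suc n) = gr_mult G f (gr_pow f n)"
  by (simp_all add: gr_pow_def)

lemma gr_mult_apply:
  "x \<in> carrier G \<Longrightarrow> gr_mult G f g x = (\<Sum>y\<in>carrier G. f y * g (inv y \<otimes> x))"
  by (simp add: gr_mult_def)

lemma gr_mult_add_left:
  "gr_mult G (\<lambda>x. f x + f' x) g = (\<lambda>x. gr_mult G f g x + gr_mult G f' g x)"
  by (auto simp: gr_mult_def fun_eq_iff algebra_simps sum.distrib)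

lemma gr_mult_cong:
  assumes "\<And>x. x \<in> carrier G \<Longrightarrow> [g x = g' x] (mod q)"
  shows "[gr_mult G f g x = gr_mult G f g' x] (mod q)"
  unfolding gr_mult_def by (auto intro!: cong_sum cong_mult assms)

lemma gr_mult_assoc:
  assumes fin: "finite (carrier G)"
  shows "gr_mult G (gr_mult G f g) h = gr_mult G f (gr_mult G g h)"
proof
  fix x
  show "gr_mult G (gr_mult G f g) h x = gr_mult G f (gr_mult G g h) x"
  proof (cases "x \<in> carrier G")
    case x: True
    have "gr_mult G (gr_mult G f g) h x =
        (\<Sum>y\<in>carrier G. \<Sum>z\<in>carrier G. f z * g (inv z \<otimes> y) * h (inv y \<otimes> x))"
      using x by (simp add: gr_mult_apply sum_distrib_right)
    also have "\<dots> = (\<Sum>z\<in>carrier G. \<Sum>y\<in>carrier G. f z * g (inv z \<otimes> y) * h (inv y \<otimes> x))"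
      by (rule sum.swap)
    also have "\<dots> = (\<Sum>z\<in>carrier G. \<Sum>w\<in>carrier G. f z * g w * h (inv w \<otimes> (inv z \<otimes> x)))"
    proof (rule sum.cong[OF refl])
      fix z assume z: "z \<in> carrier G"
      show "(\<Sum>y\<in>carrier G. f z * g (inv z \<otimes> y) * h (inv y \<otimes> x)) =
            (\<Sum>w\<in>carrier G. f z * g w * h (inv w \<otimes> (inv z \<otimes> x)))"
        by (rule sum.reindex_bij_witness[of _ "\<lambda>w. z \<otimes> w" "\<lambda>y. inv z \<otimes> y"])
          (use x z in \<open>auto simp: m_assoc inv_mult_group\<close>)
    qed
    also have "\<dots> = gr_mult G f (gr_mult G g h) x"
      using x by (simp add: gr_mult_apply sum_distrib_left mult.assoc)
    finally show ?thesis .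
  qed (simp add: gr_mult_def)
qed

text \<open>Class functions are central: the hypothesis turns \<open>inv y \<otimes> x\<close> into
  \<open>x \<otimes> inv y\<close>, which then serves as the new summation variable.\<close>

lemma gr_mult_commute_class_function:
  assumes cl: "\<And>x y. x \<in> carrier G \<Longrightarrow> y \<in> carrier G \<Longrightarrow> g (y \<otimes> x) = g (x \<otimes> y)"
  shows "gr_mult G f g = gr_mult G g f"
proof
  fix x
  show "gr_mult G f g x = gr_mult G g f x"
  proof (cases "x \<in> carrier G")
    case x: True
    have "gr_mult G f g x = (\<Sum>y\<in>carrier G. f y * g (x \<otimes> inv y))"
      unfolding gr_mult_apply[OF x] by (rule sum.cong) (use x in \<open>auto simp: cl[of x]\<close>)
    also have "\<dots> = gr_mult G g f x"
      unfolding gr_mult_apply[OF x]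
      by (rule sum.reindex_bij_witness[of _ "\<lambda>w. inv w \<otimes> x" "\<lambda>y. x \<otimes> inv y"])
        (use x in \<open>auto simp: m_assoc inv_mult_group\<close>)
    finally show ?thesis .
  qed (simp add: gr_mult_def)
qed

lemma gr_mult_uline:
  assumes "finite (carrier G)" "x \<in> carrier G" "B \<subseteq> carrier G"
  shows "gr_mult G (uline B) f x = (\<Sum>y\<in>B. f (inv y \<otimes> x))"
proof -
  have "gr_mult G (uline B) f x = (\<Sum>y\<in>carrier G. if y \<in> B then f (inv y \<otimes> x) else 0)"
    unfolding gr_mult_apply[OF assms(2)] by (rule sum.cong) (auto simp: uline_def)
  also have "\<dots> = (\<Sum>y\<in>B. f (inv y \<otimes> x))"
    using assms by (simp add: sum.If_cases Int_absorb1)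
  finally show ?thesis .
qed

lemma gr_mult_uline_uline:
  assumes "finite (carrier G)" "x \<in> carrier G" "B \<subseteq> carrier G"
  shows "gr_mult G (uline B) (uline C) x = int (card {y\<in>B. inv y \<otimes> x \<in> C})"
proof -
  have "finite B" using assms finite_subset by blast
  then show ?thesis
    unfolding gr_mult_uline[OF assms] by (simp add: uline_def sum.If_cases Int_def)
qed

section \<open>Products of lists and coefficients of powers\<close>

abbreviation list_prod :: "'a list \<Rightarrow> 'a" where
  "list_prod xs \<equiv> foldr (\<otimes>) xs \<one>"

lemma list_prod_closed: "set xs \<subseteq> carrier G \<Longrightarrow> list_prod xs \<in> carrier G"
  by (induction xs) auto

lemma list_prod_snoc:
  "set xs \<subseteq> carrier G \<Longrightarrow> x \<in> carrier G \<Longrightarrow> list_prod (xs @ [x]) = list_prod xs \<otimes> x"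
  by (induction xs) (auto simp: m_assoc list_prod_closed)

lemma list_prod_replicate:
  assumes "x \<in> carrier G" shows "list_prod (replicate n x) = x [^] n"
proof (induction n)
  case (Suc n)
  then show ?case using nat_pow_Suc2[OF assms, of n] by simp
qed simp

text \<open>Makes coefficients of powers into sizes of sets of lists, on which entrywise conjugation
  and rotation can act.\<close>

lemma gr_pow_uline:
  assumes fin: "finite (carrier G)" and B: "B \<subseteq> carrier G" and "x \<in> carrier G"
  shows "gr_pow (uline B) n x = int (card {xs. length xs = n \<and> set xs \<subseteq> B \<and> list_prod xs = x})"
  using \<open>x \<in> carrier G\<close>
proof (induction n arbitrary: x)
  case 0
  have "{xs. length xs = 0 \<and> set xs \<subseteq> B \<and> list_prod xs = x} = (if x = \<one> then {[]} else {})"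
    by auto
  then show ?case by (simp add: uline_def)
next
  case (Suc n)
  let ?L = "\<lambda>n x. {xs. length xs = n \<and> set xs \<subseteq> B \<and> list_prod xs = x}"
  have finB: "finite B" using fin B finite_subset by blast
  have finL: "finite (?L n x)" for n x
    by (rule finite_subset[OF _ finite_lists_length_eq[OF finB, of n]]) auto
  have eq: "?L (Suc n) x = (\<Union>y\<in>B. (#) y ` ?L n (inv y \<otimes> x))"
  proof (intro equalityI subsetI)
    fix xs assume "xs \<in> ?L (Suc n) x"
    then obtain y ys where xs: "xs = y # ys" "length ys = n" "y \<in> B" "set ys \<subseteq> B"
      "y \<otimes> list_prod ys = x"
      by (cases xs) auto
    then have "inv y \<otimes> x = list_prod ys"
      using B by (auto simp: list_prod_closed subset_iff)
    with xs have "xs \<in> (#) y ` ?L n (inv y \<otimes> x)" by simp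
    with xs(3) show "xs \<in> (\<Union>y\<in>B. (#) y ` ?L n (inv y \<otimes> x))" by blast
  next
    fix xs assume "xs \<in> (\<Union>y\<in>B. (#) y ` ?L n (inv y \<otimes> x))"
    then show "xs \<in> ?L (Suc n) x"
      using B Suc.prems by (auto simp: subset_iff)
  qed
  have "gr_pow (uline B) (Suc n) x = (\<Sum>y\<in>B. int (card (?L n (inv y \<otimes> x))))"
    unfolding gr_pow_simps gr_mult_uline[OF fin Suc.prems B]
    by (intro sum.cong refl Suc.IH) (use B Suc.prems in auto)
  also have "\<dots> = (\<Sum>y\<in>B. int (card ((#) y ` ?L n (inv y \<otimes> x))))"
    by (simp add: card_image)
  also have "\<dots> = int (card (\<Union>y\<in>B. (#) y ` ?L n (inv y \<otimes> x)))"
    unfolding of_nat_sum[symmetric]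
    by (rule arg_cong[where f = int], rule card_UN_disjoint[symmetric])
      (use finB finL in blast)+
  finally show ?case by (simp only: eq)
qed

end

section \<open>Fixed points of permutations of prime order\<close>

text \<open>The period of a point divides the prime \<open>p\<close>, so every point that is not
  fixed has an orbit of exactly \<open>p\<close> elements. The induction removes one such orbit from
  \<open>A\<close>.\<close>

lemma card_cong_card_fixpoints:
  assumes "Factorial_Ring.prime p" "finite A" "\<rho> ` A \<subseteq> A" "\<And>x. x \<in> A \<Longrightarrow> (\<rho> ^^ p) x = x"
  shows "[card A = card {x\<in>A. \<rho> x = x}] (mod p)"
  using assms(2-)
proof (induction "card A" arbitrary: A rule: less_induct)
  case less
  show ?case
  proof (cases "\<forall>x\<in>A. \<rho> x = x")
    case True
    then have "{x\<in>A. \<rho> x = x} = A" by auto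
    then show ?thesis by simp
  next
    case False
    then obtain x where x: "x \<in> A" "\<rho> x \<noteq> x" by auto
    have p: "p > 1" using assms(1) prime_gt_1_nat by blast
    have in_A: "(\<rho> ^^ i) y \<in> A" if "y \<in> A" for i y
      using that less.prems(2) by (induction i) auto
    have multiple: "(\<rho> ^^ (d * i)) y = y" if "(\<rho> ^^ d) y = y" for d i y
      using that by (induction i) (auto simp: funpow_add)
    have nofix: "(\<rho> ^^ d) x \<noteq> x" if d: "0 < d" "d < p" for d
    proof
      assume fix_d: "(\<rho> ^^ d) x = x"
      \<comment> \<open>By Bezout some multiple of \<open>d\<close> exceeds a multiple of
        \<open>p\<close> by one; both iterates fix \<open>x\<close>, hence so would
        \<open>\<rho>\<close>.\<close>
      have "coprime p d"
        using d assms(1) by (metis nat_dvd_not_less prime_imp_coprime)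
      then obtain a b where "d * a = p * b + 1"
        using bezout_nat[of d p] d by (auto simp: coprime_iff_gcd_eq_1 gcd.commute)
      then have "(\<rho> ^^ (d * a)) x = \<rho> ((\<rho> ^^ (p * b)) x)" by simp
      then show False
        using multiple[OF fix_d, of a] multiple[OF less.prems(3)[OF x(1)], of b] x(2) by simp
    qed
    define Orb where "Orb = (\<lambda>i. (\<rho> ^^ i) x) ` {..<p}"
    have "inj_on (\<lambda>i. (\<rho> ^^ i) x) {..<p}"
    proof (rule linorder_inj_onI)
      fix i j assume ij: "i < j" "i \<in> {..<p}" "j \<in> {..<p}"
      show "(\<rho> ^^ i) x \<noteq> (\<rho> ^^ j) x"
      proof
        assume "(\<rho> ^^ i) x = (\<rho> ^^ j) x"
        then have "(\<rho> ^^ (p - i + i)) x = (\<rho> ^^ (p - i + j)) x"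
          by (simp only: funpow_add o_apply)
        moreover have "p - i + j = (j - i) + p" "p - i + i = p" using ij by auto
        ultimately have "(\<rho> ^^ p) x = (\<rho> ^^ (j - i)) ((\<rho> ^^ p) x)"
          by (metis funpow_add o_apply)
        then have "(\<rho> ^^ (j - i)) x = x"
          using less.prems(3)[OF x(1)] by simp
        then show False using nofix[of "j - i"] ij by (simp add: less_imp_diff_less)
      qed
    qed auto
    then have card_Orb: "card Orb = p" by (simp add: Orb_def card_image)
    have Orb_A: "Orb \<subseteq> A" using in_A x(1) by (auto simp: Orb_def)
    have Orb_pow: "(\<rho> ^^ i) x \<in> Orb" for i
    proof -
      have "(\<rho> ^^ i) x = (\<rho> ^^ (i mod p + p * (i div p))) x" by simp
      also have "\<dots> = (\<rho> ^^ (i mod p)) ((\<rho> ^^ (p * (i div p))) x)"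
        by (simp only: funpow_add o_apply)
      also have "\<dots> = (\<rho> ^^ (i mod p)) x"
        using multiple[OF less.prems(3)[OF x(1)]] by simp
      finally show ?thesis using p by (auto simp: Orb_def)
    qed
    \<comment> \<open>On \<open>A\<close> the iterate \<open>\<rho> ^^ (p - 1)\<close> inverts
      \<open>\<rho>\<close>, so a point sent into the orbit already lies in it.\<close>
    have "\<rho> y \<notin> Orb" if y: "y \<in> A - Orb" for y
    proof
      assume "\<rho> y \<in> Orb"
      then obtain i where i: "\<rho> y = (\<rho> ^^ i) x" by (auto simp: Orb_def)
      have "y = (\<rho> ^^ (p - 1 + 1)) y" using less.prems(3) y p by simp
      also have "\<dots> = (\<rho> ^^ (p - 1)) (\<rho> y)" by (simp only: funpow_add o_apply) simp
      also have "\<dots> = (\<rho> ^^ (p - 1 + i)) x" by (simp only: i funpow_add o_apply)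
      finally show False using Orb_pow y by auto
    qed
    then have inv: "\<rho> ` (A - Orb) \<subseteq> A - Orb" using less.prems(2) by auto
    have finOrb: "finite Orb" by (simp add: Orb_def)
    have card_A: "card A = card (A - Orb) + p"
      using card_Diff_subset[OF finOrb Orb_A] card_mono[OF less.prems(1) Orb_A] card_Orb by simp
    have "[card (A - Orb) = card {x\<in>A - Orb. \<rho> x = x}] (mod p)"
      using less.hyps[of "A - Orb"] less.prems inv card_A p by auto
    moreover have "{x\<in>A - Orb. \<rho> x = x} = {x\<in>A. \<rho> x = x}"
    proof -
      have "\<rho> y \<noteq> y" if y: "y \<in> Orb" for y
      proof
        assume fix_y: "\<rho> y = y"
        obtain i where i: "i < p" "y = (\<rho> ^^ i) x" using y by (auto simp: Orb_def)
        have "(\<rho> ^^ (p - i)) y = (\<rho> ^^ (p - i + i)) x" by (simp only: i(2) funpow_add o_apply)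
        then have "x = (\<rho> ^^ (1 * (p - i))) y" using i less.prems(3)[OF x(1)] by simp
        also have "\<dots> = y" by (rule multiple) (simp add: fix_y)
        finally show False using fix_y x(2) by simp
      qed
      then show ?thesis by auto
    qed
    ultimately show ?thesis
      by (simp add: card_A cong_def)
  qed
qed

section \<open>Counting in conjugacy classes\<close>

context group
begin

lemma conj_nat_pow:
  "h \<in> carrier G \<Longrightarrow> x \<in> carrier G \<Longrightarrow> (h \<otimes> x \<otimes> inv h) [^] (n::nat) = h \<otimes> x [^] n \<otimes> inv h"
  by (induction n) (simp_all add: m_assoc)

lemma list_prod_conj:
  assumes "h \<in> carrier G" "set xs \<subseteq> carrier G"
  shows "list_prod (map (\<lambda>x. h \<otimes> x \<otimes> inv h) xs) = h \<otimes> list_prod xs \<otimes> inv h"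
  using assms by (induction xs) (simp_all add: m_assoc list_prod_closed)

text \<open>Conjugating all entries of a list conjugates its product, and conjugation by
  \<open>inv h\<close> undoes this, so the two sets of factorisations are in bijection.\<close>

lemma gr_pow_uline_conj:
  assumes fin: "finite (carrier G)" and B: "B \<subseteq> carrier G"
    and inv_B: "\<And>h x. h \<in> carrier G \<Longrightarrow> x \<in> B \<Longrightarrow> h \<otimes> x \<otimes> inv h \<in> B"
    and h: "h \<in> carrier G" and g: "g \<in> carrier G"
  shows "gr_pow (uline B) n (h \<otimes> g \<otimes> inv h) = gr_pow (uline B) n g"
proof -
  let ?L = "\<lambda>x. {xs. length xs = n \<and> set xs \<subseteq> B \<and> list_prod xs = x}"
  let ?c = "\<lambda>h. map (\<lambda>x. h \<otimes> x \<otimes> inv h)"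
  have map_B: "?c h xs \<in> ?L (h \<otimes> x \<otimes> inv h)" if "xs \<in> ?L x" "h \<in> carrier G" for xs x h
    using that list_prod_conj[of h xs] B inv_B by auto
  have inverse: "?c h' (?c h xs) = xs"
    if xs: "set xs \<subseteq> B" and h: "h \<in> carrier G" "h' \<in> carrier G" "h' \<otimes> h = \<one>" for h h' xs
  proof -
    have "h' = inv h" using h by (metis inv_equality)
    then have "h' \<otimes> (h \<otimes> x \<otimes> inv h) \<otimes> inv h' = x" if "x \<in> carrier G" for x
      using that h by (simp add: m_assoc)
    then show ?thesis using xs B by (auto simp: map_idI subset_iff)
  qed
  have undo: "inv h \<otimes> (h \<otimes> g \<otimes> inv h) \<otimes> inv (inv h) = g"
    using h g by (simp add: m_assoc)
  have "bij_betw (?c h) (?L g) (?L (h \<otimes> g \<otimes> inv h))"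
  proof (rule bij_betw_byWitness[where f' = "?c (inv h)"])
    show "?c h ` ?L g \<subseteq> ?L (h \<otimes> g \<otimes> inv h)" using map_B h by blast
    show "?c (inv h) ` ?L (h \<otimes> g \<otimes> inv h) \<subseteq> ?L g"
      using map_B[of _ "h \<otimes> g \<otimes> inv h" "inv h"] h unfolding undo by blast
    show "\<forall>xs\<in>?L g. ?c (inv h) (?c h xs) = xs"
      by (intro ballI inverse) (use h in auto)
    show "\<forall>xs\<in>?L (h \<otimes> g \<otimes> inv h). ?c h (?c (inv h) xs) = xs"
      by (intro ballI inverse) (use h in auto)
  qed
  then show ?thesis
    using gr_pow_uline[OF fin B] h g by (simp add: bij_betw_same_card)
qed

definition conj_class :: "'a \<Rightarrow> 'a set" where
  "conj_class g = (\<lambda>h. h \<otimes> g \<otimes> inv h) ` carrier G"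

lemma conj_class_conj:
  assumes "g \<in> carrier G" "x \<in> conj_class g" "k \<in> carrier G"
  shows "k \<otimes> x \<otimes> inv k \<in> conj_class g"
proof -
  obtain h where h: "h \<in> carrier G" "x = h \<otimes> g \<otimes> inv h"
    using assms(2) by (auto simp: conj_class_def)
  then have "k \<otimes> x \<otimes> inv k = (k \<otimes> h) \<otimes> g \<otimes> inv (k \<otimes> h)"
    using assms by (simp add: m_assoc inv_mult_group)
  then show ?thesis using h assms by (auto simp: conj_class_def)
qed

text \<open>Orbit-stabilizer: the fibre of the conjugation map over
  \<open>k \<otimes> g \<otimes> inv k\<close> is the left translate by \<open>k\<close> of the
  centralizer of \<open>g\<close>.\<close>

lemma card_conj_class:
  assumes fin: "finite (carrier G)" and g: "g \<in> carrier G"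
  shows "card (conj_class g) * card {h \<in> carrier G. h \<otimes> g = g \<otimes> h} = order G"
proof -
  let ?Z = "{h \<in> carrier G. h \<otimes> g = g \<otimes> h}"
  let ?F = "\<lambda>x. {h \<in> carrier G. h \<otimes> g \<otimes> inv h = x}"
  have card_F: "card (?F x) = card ?Z" if x: "x \<in> conj_class g" for x
  proof -
    obtain k where k: "k \<in> carrier G" "x = k \<otimes> g \<otimes> inv k"
      using x by (auto simp: conj_class_def)
    have "(inv k \<otimes> h) \<otimes> g = g \<otimes> (inv k \<otimes> h)"
      if h: "h \<in> carrier G" "h \<otimes> g \<otimes> inv h = k \<otimes> g \<otimes> inv k" for h
    proof -
      have "(inv k \<otimes> h) \<otimes> g = inv k \<otimes> (h \<otimes> g \<otimes> inv h) \<otimes> h"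
        using h(1) k(1) g by (simp add: m_assoc)
      also have "\<dots> = g \<otimes> (inv k \<otimes> h)"
        unfolding h(2) using h(1) k(1) g by (simp add: m_assoc)
      finally show ?thesis .
    qed
    moreover have "(k \<otimes> h) \<otimes> g \<otimes> inv (k \<otimes> h) = k \<otimes> g \<otimes> inv k"
      if h: "h \<in> carrier G" "h \<otimes> g = g \<otimes> h" for h
    proof -
      have "(k \<otimes> h) \<otimes> g \<otimes> inv (k \<otimes> h) = k \<otimes> (h \<otimes> g) \<otimes> inv h \<otimes> inv k"
        using h(1) k(1) g by (simp add: m_assoc inv_mult_group)
      then show ?thesis
        unfolding h(2) using h(1) k(1) g by (simp add: m_assoc)
    qed
    ultimately have "bij_betw (\<lambda>h. inv k \<otimes> h) (?F x) ?Z"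
      using k by (intro bij_betw_byWitness[where f' = "\<lambda>h. k \<otimes> h"]) auto
    then show ?thesis by (rule bij_betw_same_card)
  qed
  have fin_C: "finite (conj_class g)" using fin by (simp add: conj_class_def)
  have "order G = card (\<Union>x\<in>conj_class g. ?F x)"
    unfolding order_def by (rule arg_cong[of _ _ card]) (auto simp: conj_class_def)
  also have "\<dots> = (\<Sum>x\<in>conj_class g. card (?F x))"
    using fin fin_C by (intro card_UN_disjoint) auto
  also have "\<dots> = card (conj_class g) * card ?Z" using card_F by simp
  finally show ?thesis by simp
qed

text \<open>Cyclic rotation changes the product of a list only by a conjugation, so it permutes the
  lists of length \<open>p\<close> whose product lies in a given conjugacy class.\<close>

lemma gr_pow_prime_cong:
  assumes fin: "finite (carrier G)" and p: "Factorial_Ring.prime p" and B: "B \<subseteq> carrier G"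
    and inv_B: "\<And>h x. h \<in> carrier G \<Longrightarrow> x \<in> B \<Longrightarrow> h \<otimes> x \<otimes> inv h \<in> B"
    and g: "g \<in> carrier G" and cop: "coprime p (card (conj_class g))"
  shows "[gr_pow (uline B) p g = int (card {x\<in>B. x [^] p = g})] (mod int p)"
proof -
  let ?C = "conj_class g"
  let ?L = "\<lambda>x. {xs. length xs = p \<and> set xs \<subseteq> B \<and> list_prod xs = x}"
  let ?R = "\<lambda>y. {x\<in>B. x [^] p = y}"
  define \<Omega> where "\<Omega> = {xs. length xs = p \<and> set xs \<subseteq> B \<and> list_prod xs \<in> ?C}"
  have finB: "finite B" using fin B finite_subset by blast
  have finL: "finite (?L x)" for x
    by (rule finite_subset[OF _ finite_lists_length_eq[OF finB, of p]]) auto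
  have fin_\<Omega>: "finite \<Omega>"
    by (rule finite_subset[OF _ finite_lists_length_eq[OF finB, of p]]) (auto simp: \<Omega>_def)
  have fin_C: "finite ?C" using fin by (simp add: conj_class_def)
  have p0: "p > 0" using p prime_gt_0_nat by blast
  have card_L: "card (?L x) = card (?L g)" if x: "x \<in> ?C" for x
  proof -
    obtain h where h: "h \<in> carrier G" "x = h \<otimes> g \<otimes> inv h"
      using x by (auto simp: conj_class_def)
    show ?thesis
      using gr_pow_uline_conj[OF fin B inv_B h(1) g, of p] gr_pow_uline[OF fin B] h g by simp
  qed
  have card_R: "card (?R y) = card (?R g)" if y: "y \<in> ?C" for y
  proof -
    obtain h where h: "h \<in> carrier G" "y = h \<otimes> g \<otimes> inv h"
      using y by (auto simp: conj_class_def)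
    have undo: "inv h \<otimes> y \<otimes> inv (inv h) = g" using h g by (simp add: m_assoc)
    have "bij_betw (\<lambda>x. h \<otimes> x \<otimes> inv h) (?R g) (?R y)"
    proof (rule bij_betw_byWitness[where f' = "\<lambda>x. inv h \<otimes> x \<otimes> inv (inv h)"])
      show "(\<lambda>x. h \<otimes> x \<otimes> inv h) ` ?R g \<subseteq> ?R y"
        using h inv_B B conj_nat_pow by auto
      show "(\<lambda>x. inv h \<otimes> x \<otimes> inv (inv h)) ` ?R y \<subseteq> ?R g"
        using h(1) inv_B[of "inv h"] B conj_nat_pow[of "inv h" _ p] undo by (auto simp del: inv_inv)
    qed (use h B in \<open>auto simp: m_assoc subset_iff\<close>)
    then show ?thesis by (simp add: bij_betw_same_card)
  qed
  have "\<Omega> = (\<Union>x\<in>?C. ?L x)" by (auto simp: \<Omega>_def)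
  then have "card \<Omega> = (\<Sum>x\<in>?C. card (?L x))"
    using fin_C finL by (simp only:) (rule card_UN_disjoint, auto)
  then have card_\<Omega>: "card \<Omega> = card ?C * card (?L g)" using card_L by simp
  have rotate: "rotate1 ` \<Omega> \<subseteq> \<Omega>"
  proof
    fix ys assume "ys \<in> rotate1 ` \<Omega>"
    then obtain xs where xs: "xs \<in> \<Omega>" "ys = rotate1 xs" by auto
    then obtain x zs where Cons: "xs = x # zs" using p0 by (cases xs) (auto simp: \<Omega>_def)
    have x: "x \<in> carrier G" "set zs \<subseteq> carrier G" and "x \<otimes> list_prod zs \<in> ?C"
      using xs Cons B by (auto simp: \<Omega>_def)
    then have "inv x \<otimes> (x \<otimes> list_prod zs) \<otimes> inv (inv x) \<in> ?C"
      by (intro conj_class_conj g) auto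
    then have "list_prod zs \<otimes> x \<in> ?C" using x by (simp add: list_prod_closed)
    then have "list_prod ys \<in> ?C" using xs(2) Cons x by (simp only: list_prod_snoc rotate1.simps)
    then show "ys \<in> \<Omega>" using xs by (auto simp: \<Omega>_def)
  qed
  \<comment> \<open>A list fixed by a single rotation is constant, so its product is the
    \<open>p\<close>-th power of its entry.\<close>
  have fix_eq: "{xs\<in>\<Omega>. rotate1 xs = xs} = replicate p ` (\<Union>y\<in>?C. ?R y)"
  proof (intro equalityI subsetI)
    fix xs assume "xs \<in> {xs\<in>\<Omega>. rotate1 xs = xs}"
    then have xs: "xs \<in> \<Omega>" "rotate1 xs = xs" by auto
    then have "card (set xs) = 1" using rotate1_fixpoint_card p0 by (fastforce simp: \<Omega>_def)
    then obtain x where x: "set xs = {x}" by (auto simp: card_1_singleton_iff)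
    then have eq: "xs = replicate p x" using xs(1)
      by (metis (mono_tags, lifting) \<Omega>_def mem_Collect_eq replicate_eqI singletonD)
    then have "x \<in> B" "x [^] p \<in> ?C"
      using xs(1) x B list_prod_replicate[of x p] by (auto simp: \<Omega>_def)
    then show "xs \<in> replicate p ` (\<Union>y\<in>?C. ?R y)" using eq by auto
  next
    fix xs assume "xs \<in> replicate p ` (\<Union>y\<in>?C. ?R y)"
    then obtain x where "xs = replicate p x" "x \<in> B" "x [^] p \<in> ?C" by auto
    then show "xs \<in> {xs\<in>\<Omega>. rotate1 xs = xs}"
      using B list_prod_replicate[of x p] by (auto simp: \<Omega>_def subset_iff)
  qed
  have "inj_on (replicate p) (\<Union>y\<in>?C. ?R y)" using p0 by (auto simp: inj_on_def replicate_eq_replicate)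
  then have "card {xs\<in>\<Omega>. rotate1 xs = xs} = card (\<Union>y\<in>?C. ?R y)"
    unfolding fix_eq by (rule card_image)
  also have "\<dots> = (\<Sum>y\<in>?C. card (?R y))"
    using fin_C finB by (intro card_UN_disjoint) auto
  also have "\<dots> = card ?C * card (?R g)" using card_R by simp
  finally have card_fix: "card {xs\<in>\<Omega>. rotate1 xs = xs} = card ?C * card (?R g)" .
  have "(rotate1 ^^ p) xs = xs" if "xs \<in> \<Omega>" for xs
    using that rotate_id[of p xs] by (auto simp: \<Omega>_def rotate_def)
  from card_cong_card_fixpoints[OF p fin_\<Omega> rotate this]
  have "[card ?C * card (?L g) = card ?C * card (?R g)] (mod p)"
    unfolding card_\<Omega> card_fix .
  \<comment> \<open>Both sides were counted over the whole class, each member contributing equally;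
    coprimality lets the class size be cancelled.\<close>
  then have "[card (?L g) = card (?R g)] (mod p)"
    using cop by (simp add: cong_mult_lcancel_nat coprime_commute)
  then show ?thesis
    unfolding gr_pow_uline[OF fin B g] by (simp add: cong_int_iff)
qed

end

section \<open>Normal cyclic Sylow subgroups\<close>

lemma (in group) card_subgroup_dvd:
  assumes "subgroup H G" "subgroup K G" "H \<subseteq> K"
  shows "card H dvd card K"
proof -
  have "order (G\<lparr>carrier := K\<rparr>) = card K" by (simp add: order_def)
  then show ?thesis
    using group.lagrange[OF subgroup_imp_group[OF assms(2)] subgroup_incl[OF assms]]
    by (metis dvd_triv_right)
qed

text \<open>The Sylow property is carried by \<open>card_P\<close> and \<open>coprime_index\<close>;
  \<open>k_pos\<close> expresses that \<open>p\<close> divides the group order.\<close>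

locale normal_cyclic_sylow = group +
  fixes p k :: nat and P :: "'a set" and w :: 'a
  assumes fin: "finite (carrier G)"
    and prime_p: "Factorial_Ring.prime p"
    and normal_P: "P \<lhd> G"
    and w: "w \<in> carrier G"
    and P_eq: "P = range (\<lambda>i::int. w [^] i)"
    and card_P: "card P = p ^ k"
    and k_pos: "k > 0"
    and coprime_index: "coprime p (order G div card P)"
begin

lemma p_gt_1: "p > 1"
  using prime_p prime_gt_1_nat by blast

lemma subgroup_P: "subgroup P G"
  using normal_P normal_imp_subgroup by blast

lemma P_subset: "P \<subseteq> carrier G"
  using subgroup_P subgroup.subset by blast

lemma P_carrier [simp]: "u \<in> P \<Longrightarrow> u \<in> carrier G"
  using P_subset by blast

lemma P_closed [simp]: "u \<in> P \<Longrightarrow> v \<in> P \<Longrightarrow> u \<otimes> v \<in> P" "u \<in> P \<Longrightarrow> inv u \<in> P" "\<one> \<in> P"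
  using subgroup_P by (auto simp: subgroup.m_closed subgroup.m_inv_closed subgroup.one_closed)

lemma P_pow_closed [simp]: "u \<in> P \<Longrightarrow> u [^] (n::nat) \<in> P"
  by (induction n) auto

lemma P_comm: "u \<in> P \<Longrightarrow> v \<in> P \<Longrightarrow> u \<otimes> v = v \<otimes> u"
  using w by (auto simp: P_eq int_pow_mult[symmetric] add.commute)

lemma P_conj: "x \<in> carrier G \<Longrightarrow> u \<in> P \<Longrightarrow> x \<otimes> u \<otimes> inv x \<in> P"
  using normal_P by (simp add: normal.inv_op_closed2)

lemma P_conj': "x \<in> carrier G \<Longrightarrow> u \<in> P \<Longrightarrow> inv x \<otimes> u \<otimes> x \<in> P"
  using normal_P by (simp add: normal.inv_op_closed1)

lemma index: "order G = card P * (order G div card P)"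
  using lagrange[OF subgroup_P] by (metis dvd_mult_div_cancel dvd_triv_right)

lemma ord_w: "ord w = p ^ k"
proof -
  have "generate G {w} = P" using w by (auto simp: generate_pow P_eq)
  then show ?thesis using generate_pow_card[OF w] card_P by simp
qed

text \<open>Lagrange's theorem in the quotient by \<open>P\<close>, whose order is the
  index.\<close>

lemma pow_index_in_P:
  assumes "x \<in> carrier G" shows "x [^] (order G div card P) \<in> P"
proof -
  interpret N: normal P G by (rule normal_P)
  interpret F: group "G Mod P" by (rule N.factorgroup_is_group)
  have ord_F: "order (G Mod P) = order G div card P"
    using lagrange[OF subgroup_P] card_P p_gt_1
    by (metis (no_types, lifting) FactGroup_def N.subgroup_axioms nonzero_mult_div_cancel_right
        not_less_zero order_def partial_object.select_convs(1) power_eq_0_iff zero_less_one_class.zero_le_one zero_neq_one not_one_less_zero)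
  have "(P #> x) [^]\<^bsub>G Mod P\<^esub> order (G Mod P) = P"
    using F.pow_order_eq_1[of "P #> x"] assms by (auto simp: carrier_FactGroup)
  then have "P #> (x [^] (order G div card P)) = P"
    using N.FactGroup_pow[OF assms] ord_F by simp
  then show ?thesis
    using rcos_self[of "x [^] (order G div card P)" P] assms subgroup_P by auto
qed

section \<open>The socle of the cyclic Sylow subgroup\<close>

definition socle :: "'a set" where
  "socle = {u \<in> P. u [^] p = \<one>}"

lemma socle_carrier [simp]: "u \<in> socle \<Longrightarrow> u \<in> carrier G"
  by (simp add: socle_def)

lemma socle_subset: "socle \<subseteq> P"
  by (auto simp: socle_def)

lemma one_in_socle [simp]: "\<one> \<in> socle"
  by (simp add: socle_def)

lemma subgroup_socle: "subgroup socle G"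
proof (rule subgroupI)
  show "socle \<noteq> {}" using one_in_socle by blast
qed (auto simp: socle_def nat_pow_inv pow_mult_distrib P_comm)

lemma socle_conj: "x \<in> carrier G \<Longrightarrow> u \<in> socle \<Longrightarrow> x \<otimes> u \<otimes> inv x \<in> socle"
  by (auto simp: socle_def P_conj conj_nat_pow)

lemma socle_conj': "x \<in> carrier G \<Longrightarrow> u \<in> socle \<Longrightarrow> inv x \<otimes> u \<otimes> x \<in> socle"
  using socle_conj[of "inv x" u] by simp

lemma card_socle_powers:
  assumes "v \<in> socle" "v \<noteq> \<one>"
  shows "card ((\<lambda>t::nat. v [^] t) ` {..<p}) = p" "(\<lambda>t::nat. v [^] t) ` {..<p} \<subseteq> socle"
proof -
  have v: "v \<in> carrier G" "v [^] p = \<one>" using assms by (auto simp: socle_def)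
  then have "ord v dvd p" by (simp add: pow_eq_id)
  moreover have "ord v \<noteq> 1" using ord_eq_1 v assms by blast
  ultimately have "ord v = p" using prime_p by (metis prime_nat_iff)
  moreover have "{0..p - 1} = {..<p}" using p_gt_1 by auto
  ultimately show "card ((\<lambda>t::nat. v [^] t) ` {..<p}) = p"
    using ord_inj[OF v(1)] by (simp add: card_image)
  have "v [^] t \<in> socle" for t :: nat
    using subgroup_socle assms(1) by (induction t) (auto simp: subgroup.m_closed)
  then show "(\<lambda>t::nat. v [^] t) ` {..<p} \<subseteq> socle" by auto
qed

lemma finite_socle: "finite socle"
  using fin socle_subset P_subset finite_subset by (metis)

text \<open>The generator \<open>w\<close> has order \<open>p ^ k\<close>, so \<open>v\<close>, its
  power with exponent \<open>p ^ (k - 1)\<close>, has order \<open>p\<close>. An element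
  \<open>w [^] i\<close> whose \<open>p\<close>-th power is trivial has \<open>i\<close> divisible
  by \<open>p ^ (k - 1)\<close> and is therefore a power of \<open>v\<close>.\<close>

lemma card_socle: "card socle = p"
proof -
  define K where "K = p ^ (k - 1)"
  have K: "K * p = p ^ k" "K > 0"
    unfolding K_def using power_minus_mult[OF k_pos] p_gt_1 by auto
  define v where "v = w [^] K"
  have "ord w = K * p" using K(1) ord_w by simp
  then have "ord v = p"
    unfolding v_def using ord_pow[OF w, of K] K(2) by simp
  moreover have "v \<in> carrier G" using w by (simp add: v_def)
  ultimately have "v \<noteq> \<one>" "v [^] p = \<one>" using p_gt_1 pow_eq_id[of v p] ord_id by auto
  moreover have "v \<in> P" unfolding v_def P_eq by (metis int_pow_int rangeI)
  ultimately have v: "v \<in> socle" "v \<noteq> \<one>" by (auto simp: socle_def)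
  have "socle \<subseteq> (\<lambda>t::nat. v [^] t) ` {..<p}"
  proof
    fix u assume "u \<in> socle"
    then have u_P: "u \<in> P" "u [^] p = \<one>" by (auto simp: socle_def)
    then obtain i :: int where u: "u = w [^] i" by (auto simp: P_eq)
    then have "w [^] (i * int p) = \<one>" using u_P(2) w by (metis int_pow_int int_pow_pow)
    then have "int (K * p) dvd i * int p" using w K(1) by (simp add: int_pow_eq_id ord_w)
    then have "int K dvd i" using p_gt_1 by simp
    then obtain q where q: "i = int K * q" by (elim dvdE)
    have vw: "v [^] j = w [^] (int K * j)" for j :: int
      unfolding v_def using w by (metis int_pow_int int_pow_pow)
    have "w [^] i = w [^] (int K * (q mod int p))"
    proof -
      have "int K * (q mod int p) - i = int (K * p) * (- (q div int p))"
        unfolding q minus_mult_div_eq_mod[symmetric] by (simp add: algebra_simps)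
      then show ?thesis using w unfolding int_pow_eq[OF w] ord_w K(1) by (metis dvd_triv_left)
    qed
    then have "u = v [^] nat (q mod int p)"
      using p_gt_1 by (simp add: u flip: vw int_pow_int)
    moreover have "nat (q mod int p) < p" using p_gt_1 by (simp add: nat_less_iff)
    ultimately show "u \<in> (\<lambda>t::nat. v [^] t) ` {..<p}" by blast
  qed
  then show ?thesis
    using card_socle_powers[OF v] by (metis subset_antisym)
qed

text \<open>A nontrivial \<open>v\<close> in \<open>I\<close> has order \<open>p ^ s\<close> with
  \<open>s > 0\<close>. Its power with exponent \<open>p ^ (s - 1)\<close> has order
  \<open>p\<close>, and the powers of that element exhaust the socle by cardinality.\<close>

lemma socle_minimal:
  assumes I: "subgroup I G" "I \<subseteq> P" "v \<in> I" "v \<noteq> \<one>"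
  shows "socle \<subseteq> I"
proof -
  have v: "v \<in> carrier G" "v \<in> P" using I by auto
  have "v [^] (p ^ k) = \<one>"
  proof -
    obtain i :: int where "v = w [^] i" using v(2) by (auto simp: P_eq)
    then have "v [^] (p ^ k) = w [^] (i * int (p ^ k))" using w by (metis int_pow_int int_pow_pow)
    then show ?thesis using w by (simp add: int_pow_eq_id ord_w)
  qed
  then have "ord v dvd p ^ k" using v by (simp add: pow_eq_id)
  then obtain s where s: "ord v = p ^ s" using prime_p divides_primepow_nat by blast
  have "s \<noteq> 0" using s ord_eq_1[OF v(1)] I(4) by auto
  then have s': "p ^ (s - 1) * p = p ^ s" using power_minus_mult[of s p] by blast
  define u where "u = v [^] (p ^ (s - 1))"
  have "ord u = p" unfolding u_def
    using ord_pow[OF v(1), of "p ^ (s - 1)"] s s' p_gt_1 by (metis dvd_triv_left nonzero_mult_div_cancel_left power_eq_0_iff not_one_less_zero)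
  moreover have "u \<in> carrier G" using v by (simp add: u_def)
  ultimately have "u \<noteq> \<one>" "u [^] p = \<one>" using p_gt_1 pow_eq_id[of u p] ord_id by auto
  then have u: "u \<in> socle" "u \<noteq> \<one>" using v by (auto simp: socle_def u_def)
  have "v [^] n \<in> I" for n :: nat
    using I by (induction n) (auto simp: subgroup.m_closed subgroup.one_closed)
  then have "u [^] t \<in> I" for t :: nat using v by (simp add: u_def nat_pow_pow)
  moreover have "(\<lambda>t::nat. u [^] t) ` {..<p} = socle"
    using card_socle_powers[OF u] card_socle finite_socle by (intro card_subset_eq) auto
  ultimately show ?thesis by (metis image_subsetI)
qed

section \<open>The centralizer of the Sylow subgroup\<close>

definition P_centralizer :: "'a set" where
  "P_centralizer = {x \<in> carrier G. \<forall>u\<in>P. x \<otimes> u = u \<otimes> x}"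

lemma P_centralizer_carrier [simp]: "x \<in> P_centralizer \<Longrightarrow> x \<in> carrier G"
  by (simp add: P_centralizer_def)

lemma P_centralizer_comm: "x \<in> P_centralizer \<Longrightarrow> u \<in> P \<Longrightarrow> x \<otimes> u = u \<otimes> x"
  unfolding P_centralizer_def by blast

lemma P_centralizerI:
  "x \<in> carrier G \<Longrightarrow> (\<And>u. u \<in> P \<Longrightarrow> x \<otimes> u = u \<otimes> x) \<Longrightarrow> x \<in> P_centralizer"
  unfolding P_centralizer_def by blast

lemma P_P_centralizer: "P \<subseteq> P_centralizer"
  by (auto intro!: P_centralizerI P_comm)

lemma subgroup_P_centralizer: "subgroup P_centralizer G"
proof (rule subgroupI)
  fix a assume a: "a \<in> P_centralizer"
  have "inv a \<otimes> u = u \<otimes> inv a" if u: "u \<in> P" for u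
  proof -
    have "inv a \<otimes> u = inv a \<otimes> (u \<otimes> a) \<otimes> inv a" using a u by (simp add: m_assoc)
    also have "\<dots> = inv a \<otimes> (a \<otimes> u) \<otimes> inv a" using P_centralizer_comm[OF a u] by simp
    also have "\<dots> = u \<otimes> inv a" using a u by simp
    finally show ?thesis .
  qed
  then show "inv a \<in> P_centralizer" using a by (intro P_centralizerI) auto
next
  fix a b assume ab: "a \<in> P_centralizer" "b \<in> P_centralizer"
  have "a \<otimes> b \<otimes> u = u \<otimes> (a \<otimes> b)" if u: "u \<in> P" for u
    using ab u by (metis P_centralizer_carrier P_centralizer_comm m_assoc P_carrier)
  then show "a \<otimes> b \<in> P_centralizer" using ab by (intro P_centralizerI) auto
next
  show "P_centralizer \<noteq> {}" using P_P_centralizer P_closed(3) by blast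
qed auto

text \<open>Centralizers of normal subgroups are normal: \<open>x\<close> commutes with
  \<open>inv h \<otimes> u \<otimes> h\<close>, which again lies in \<open>P\<close>.\<close>

lemma P_centralizer_conj:
  assumes h: "h \<in> carrier G" and x: "x \<in> P_centralizer"
  shows "h \<otimes> x \<otimes> inv h \<in> P_centralizer"
proof -
  have "h \<otimes> x \<otimes> inv h \<otimes> u = u \<otimes> (h \<otimes> x \<otimes> inv h)" if u: "u \<in> P" for u
  proof -
    have "h \<otimes> x \<otimes> inv h \<otimes> u = h \<otimes> (x \<otimes> (inv h \<otimes> u \<otimes> h)) \<otimes> inv h"
      using h x u by (simp add: m_assoc)
    also have "\<dots> = h \<otimes> ((inv h \<otimes> u \<otimes> h) \<otimes> x) \<otimes> inv h"
      using P_centralizer_comm[OF x P_conj'[OF h u]] by simp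
    also have "\<dots> = u \<otimes> (h \<otimes> x \<otimes> inv h)"
      using h x u by (simp add: m_assoc)
    finally show ?thesis .
  qed
  then show ?thesis using h x by (intro P_centralizerI) auto
qed

text \<open>Outside the centralizer of \<open>P\<close> the commutators with \<open>y\<close> form a nontrivial subgroup
  of \<open>P\<close>, which therefore contains the socle.\<close>

lemma mult_socle_conj:
  assumes y: "y \<in> carrier G" "y \<notin> P_centralizer" and u: "u \<in> socle"
  obtains h where "h \<in> carrier G" "y \<otimes> u = h \<otimes> y \<otimes> inv h"
proof -
  \<comment> \<open>\<open>\<theta> h\<close> is the commutator with
    \<open>y \<otimes> \<theta> h = h \<otimes> y \<otimes> inv h\<close>; on \<open>P\<close> it is
    multiplicative because \<open>P\<close> is abelian and normal.\<close>
  define \<theta> where "\<theta> h = (inv y \<otimes> h \<otimes> y) \<otimes> inv h" for h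
  have \<theta>_P: "\<theta> h \<in> P" if "h \<in> P" for h
    using that y P_conj' by (simp add: \<theta>_def)
  have \<theta>_mult: "\<theta> (h \<otimes> h') = \<theta> h \<otimes> \<theta> h'" if h: "h \<in> P" "h' \<in> P" for h h'
  proof -
    have c: "inv y \<otimes> h' \<otimes> y \<in> P" using P_conj' y h by blast
    have "\<theta> (h \<otimes> h') = (inv y \<otimes> h \<otimes> y) \<otimes> ((inv y \<otimes> h' \<otimes> y) \<otimes> (inv h' \<otimes> inv h))"
      using h y by (simp add: \<theta>_def m_assoc inv_mult_group)
    also have "(inv y \<otimes> h' \<otimes> y) \<otimes> (inv h' \<otimes> inv h) = inv h \<otimes> ((inv y \<otimes> h' \<otimes> y) \<otimes> inv h')"
      using P_comm[OF P_closed(2)[OF h(1)] P_closed(1)[OF c P_closed(2)[OF h(2)]]] h y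
      by (simp add: m_assoc)
    finally show ?thesis using h y by (simp add: \<theta>_def m_assoc)
  qed
  have sub: "subgroup (\<theta> ` P) G"
  proof (rule subgroupI)
    show "\<theta> ` P \<subseteq> carrier G" using \<theta>_P by auto
    show "\<theta> ` P \<noteq> {}" using P_closed(3) by blast
    fix a b assume "a \<in> \<theta> ` P" "b \<in> \<theta> ` P"
    then show "a \<otimes> b \<in> \<theta> ` P" using \<theta>_mult by (auto simp flip: \<theta>_mult)
  next
    fix a assume "a \<in> \<theta> ` P"
    then obtain h where h: "h \<in> P" "a = \<theta> h" by auto
    have "\<theta> (inv h) \<otimes> \<theta> h = \<one>"
      using \<theta>_mult[of "inv h" h] h y by (simp add: \<theta>_def)
    then have "inv a = \<theta> (inv h)" using h \<theta>_P by (simp add: inv_equality)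
    then show "inv a \<in> \<theta> ` P" using h by simp
  qed
  obtain h0 where h0: "h0 \<in> P" "y \<otimes> h0 \<noteq> h0 \<otimes> y" using y P_centralizerI by blast
  have "\<theta> h0 \<noteq> \<one>"
  proof
    assume "\<theta> h0 = \<one>"
    then have "h0 = inv y \<otimes> h0 \<otimes> y"
      using inv_equality[of "inv y \<otimes> h0 \<otimes> y" "inv h0"] h0(1) y by (simp add: \<theta>_def)
    then have "y \<otimes> h0 = y \<otimes> (inv y \<otimes> h0 \<otimes> y)" by simp
    then show False using h0 y by (simp add: m_assoc)
  qed
  then have "socle \<subseteq> \<theta> ` P"
    using h0 \<theta>_P by (intro socle_minimal[OF sub]) auto
  then obtain h where h: "h \<in> P" "u = \<theta> h" using u by auto
  then have "y \<otimes> u = h \<otimes> y \<otimes> inv h" using y by (simp add: \<theta>_def m_assoc)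
  then show thesis using that P_carrier[OF h(1)] by blast
qed

text \<open>The centralizer of \<open>g\<close> contains \<open>P\<close>, so the class size divides
  the index of \<open>P\<close>.\<close>

lemma coprime_card_conj_class:
  assumes g: "g \<in> P_centralizer"
  shows "coprime p (card (conj_class g))"
proof -
  let ?Z = "{h \<in> carrier G. h \<otimes> g = g \<otimes> h}"
  have g': "g \<in> carrier G" using g by simp
  have sub: "subgroup ?Z G"
  proof (rule subgroupI)
    fix a assume "a \<in> ?Z"
    then have a: "a \<in> carrier G" "a \<otimes> g = g \<otimes> a" by auto
    have "inv a \<otimes> g = inv a \<otimes> (g \<otimes> a) \<otimes> inv a" using a(1) g' by (simp add: m_assoc)
    also have "g \<otimes> a = a \<otimes> g" using a(2) by simp
    also have "inv a \<otimes> (a \<otimes> g) \<otimes> inv a = g \<otimes> inv a" using a(1) g' by simp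
    finally show "inv a \<in> ?Z" using a(1) by simp
  next
    fix a b assume "a \<in> ?Z" "b \<in> ?Z"
    then show "a \<otimes> b \<in> ?Z" using g' by simp (metis m_assoc)
  qed (use g' in auto)
  have "P \<subseteq> ?Z" using g P_centralizer_comm by auto
  then have "card P dvd card ?Z" by (rule card_subgroup_dvd[OF subgroup_P sub])
  then obtain e where e: "card ?Z = card P * e" by (rule dvdE)
  then have "card P * (card (conj_class g) * e) = card P * (order G div card P)"
    using card_conj_class[OF fin g'] index unfolding e by (simp add: ac_simps)
  then have "card (conj_class g) * e = order G div card P"
    using card_P p_gt_1 by simp
  then show ?thesis using coprime_index by (metis coprime_mult_right_iff)
qed

end

section \<open>The Frobenius map on class functions\<close>

lemma (in group) gr_mult_add_scale_right:
  "gr_mult G f (\<lambda>x. g x + c * h x) = (\<lambda>x. gr_mult G f g x + c * gr_mult G f h x)"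
  by (auto simp: gr_mult_def fun_eq_iff algebra_simps sum.distrib sum_distrib_left)

context normal_cyclic_sylow
begin

text \<open>Right multiplication by a nontrivial socle element acts on \<open>B\<close> with period
  \<open>p\<close> and without fixed points.\<close>

lemma prime_dvd_card_socle_invariant:
  assumes B: "B \<subseteq> carrier G" "\<And>y u. y \<in> B \<Longrightarrow> u \<in> socle \<Longrightarrow> y \<otimes> u \<in> B"
  shows "p dvd card B"
proof -
  have "socle \<noteq> {\<one>}" using card_socle p_gt_1 by auto
  then obtain v where v: "v \<in> socle" "v \<noteq> \<one>" using one_in_socle by blast
  have v': "v \<in> carrier G" "v [^] p = \<one>" using v by (auto simp: socle_def)
  have iter: "((\<lambda>y. y \<otimes> v) ^^ n) y = y \<otimes> v [^] n" if "y \<in> B" for y n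
    using that B(1) v'(1) by (induction n) (auto simp: m_assoc)
  have "[card B = card {y\<in>B. y \<otimes> v = y}] (mod p)"
  proof (rule card_cong_card_fixpoints[OF prime_p])
    show "finite B" using B(1) fin finite_subset by blast
    show "(\<lambda>y. y \<otimes> v) ` B \<subseteq> B" using B(2) v by auto
    show "((\<lambda>y. y \<otimes> v) ^^ p) y = y" if "y \<in> B" for y
      using iter[OF that, of p] v' that B(1) by auto
  qed
  moreover have "{y\<in>B. y \<otimes> v = y} = {}" using v v' B(1) by auto
  ultimately show ?thesis by (simp add: cong_0_iff)
qed

text \<open>The level sets of \<open>F\<close> are themselves closed under the socle, so each
  contributes a multiple of \<open>p\<close>.\<close>

lemma prime_dvd_sum_socle_invariant:
  fixes F :: "'a \<Rightarrow> int"
  assumes B: "B \<subseteq> carrier G" "\<And>y u. y \<in> B \<Longrightarrow> u \<in> socle \<Longrightarrow> y \<otimes> u \<in> B"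
    and F: "\<And>y u. y \<in> B \<Longrightarrow> u \<in> socle \<Longrightarrow> F (y \<otimes> u) = F y"
  shows "int p dvd sum F B"
proof -
  have "finite B" using B(1) fin finite_subset by blast
  then have "sum F B = (\<Sum>c\<in>F ` B. sum F {y\<in>B. F y = c})"
    by (rule sum.image_gen)
  also have "int p dvd \<dots>"
  proof (rule dvd_sum)
    fix c
    have "p dvd card {y\<in>B. F y = c}"
      by (rule prime_dvd_card_socle_invariant) (use B F in auto)
    then show "int p dvd sum F {y\<in>B. F y = c}" by simp
  qed
  finally show ?thesis .
qed

section \<open>Powers of a conjugation-invariant set modulo p\<close>

context
  fixes B :: "'a set"
  assumes B: "B \<subseteq> carrier G"
    and B_conj: "\<And>h x. h \<in> carrier G \<Longrightarrow> x \<in> B \<Longrightarrow> h \<otimes> x \<otimes> inv h \<in> B"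
begin

lemma outer_conj:
  assumes "h \<in> carrier G" "x \<in> B - P_centralizer"
  shows "h \<otimes> x \<otimes> inv h \<in> B - P_centralizer"
proof -
  have x: "x \<in> carrier G" using assms B by auto
  have "h \<otimes> x \<otimes> inv h \<notin> P_centralizer"
  proof
    assume "h \<otimes> x \<otimes> inv h \<in> P_centralizer"
    then have "inv h \<otimes> (h \<otimes> x \<otimes> inv h) \<otimes> inv (inv h) \<in> P_centralizer"
      by (rule P_centralizer_conj[OF inv_closed[OF assms(1)]])
    then show False using assms x by (simp add: m_assoc)
  qed
  then show ?thesis using assms B_conj by blast
qed

lemma outer_mult_socle:
  assumes "y \<in> B - P_centralizer" "u \<in> socle"
  shows "y \<otimes> u \<in> B - P_centralizer"
proof -
  obtain h where "h \<in> carrier G" "y \<otimes> u = h \<otimes> y \<otimes> inv h"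
    using mult_socle_conj[of y u] assms B by auto
  then show ?thesis using outer_conj assms(1) by auto
qed

text \<open>Normality of the socle moves \<open>u\<close> to the right of \<open>y\<close>, where
  \<open>outer_mult_socle\<close> applies.\<close>

lemma outer_socle_mult:
  assumes "y \<in> B - P_centralizer" "u \<in> socle"
  shows "u \<otimes> y \<in> B - P_centralizer"
proof -
  have y: "y \<in> carrier G" using assms B by auto
  have "y \<otimes> (inv y \<otimes> u \<otimes> y) \<in> B - P_centralizer"
    using outer_mult_socle[OF assms(1)] socle_conj' y assms(2) by blast
  then show ?thesis using y assms by (simp add: m_assoc)
qed

text \<open>Replacing \<open>y\<close> by \<open>y \<otimes> u\<close> keeps the summation range
  and, by the invariance of \<open>h\<close>, the summand, so
  \<open>prime_dvd_sum_socle_invariant\<close> applies.\<close>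

lemma outer_mult_cong_0:
  assumes h: "\<And>u x. u \<in> socle \<Longrightarrow> x \<in> carrier G \<Longrightarrow> h (u \<otimes> x) = h x"
    and x: "x \<in> carrier G"
  shows "int p dvd gr_mult G (uline (B - P_centralizer)) h x"
proof -
  have "B - P_centralizer \<subseteq> carrier G" using B by auto
  moreover have "h (inv (y \<otimes> u) \<otimes> x) = h (inv y \<otimes> x)"
    if "y \<in> B - P_centralizer" "u \<in> socle" for y u
  proof -
    have y: "y \<in> carrier G" using that B by auto
    have "inv (y \<otimes> u) \<otimes> x = inv u \<otimes> (inv y \<otimes> x)"
      using y that(2) x by (simp add: inv_mult_group m_assoc)
    then show ?thesis
      using h[of "inv u" "inv y \<otimes> x"] y that(2) x subgroup.m_inv_closed[OF subgroup_socle] by simp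
  qed
  ultimately show ?thesis
    unfolding gr_mult_uline[OF fin x \<open>B - P_centralizer \<subseteq> carrier G\<close>]
    by (intro prime_dvd_sum_socle_invariant outer_mult_socle) auto
qed

text \<open>Supplies the hypothesis of \<open>outer_mult_cong_0\<close>: a product with an outer
  factor on the left is invariant, hence a second outer factor makes it vanish modulo
  \<open>p\<close>.\<close>

lemma outer_mult_invariant:
  assumes u: "u \<in> socle" and x: "x \<in> carrier G"
  shows "gr_mult G (uline (B - P_centralizer)) h (u \<otimes> x) = gr_mult G (uline (B - P_centralizer)) h x"
proof -
  have sub: "B - P_centralizer \<subseteq> carrier G" using B by auto
  have "(\<Sum>y\<in>B - P_centralizer. h (inv y \<otimes> (u \<otimes> x))) = (\<Sum>y\<in>B - P_centralizer. h (inv y \<otimes> x))"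
  proof (rule sum.reindex_bij_witness[of _ "\<lambda>y. u \<otimes> y" "\<lambda>y. inv u \<otimes> y"])
    fix y assume y: "y \<in> B - P_centralizer"
    then show "inv u \<otimes> y \<in> B - P_centralizer" "u \<otimes> y \<in> B - P_centralizer"
      using outer_socle_mult u subgroup.m_inv_closed[OF subgroup_socle] by blast+
    have "y \<in> carrier G" using y B by auto
    then show "u \<otimes> (inv u \<otimes> y) = y" "inv u \<otimes> (u \<otimes> y) = y"
      "h (inv (inv u \<otimes> y) \<otimes> x) = h (inv y \<otimes> (u \<otimes> x))"
      using u x by (simp_all add: inv_mult_group m_assoc)
  qed
  then show ?thesis using u x by (simp add: gr_mult_uline[OF fin _ sub])
qed

text \<open>Binomial expansion in the inner and outer parts of \<open>B\<close>. The outer part is a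
  class function, so it commutes with the inner one, and terms containing it twice vanish modulo
  \<open>p\<close>; only degrees zero and one survive.\<close>

lemma gr_pow_cong_outer:
  assumes "x \<in> carrier G"
  shows "[gr_pow (uline B) (Suc n) x = gr_pow (uline (B \<inter> P_centralizer)) (Suc n) x + int (Suc n) *
      gr_mult G (uline (B - P_centralizer)) (gr_pow (uline (B \<inter> P_centralizer)) n) x] (mod int p)"
  using assms
proof (induction n arbitrary: x)
  let ?z1 = "uline (B \<inter> P_centralizer)" and ?z2 = "uline (B - P_centralizer)"
  have z: "uline B = (\<lambda>x. ?z1 x + ?z2 x)" by (auto simp: uline_def)
  {
    case 0
    show ?case unfolding z by (simp add: gr_mult_add_left)
  next
    case (Suc n)
    let ?w = "gr_mult G ?z2 (gr_pow ?z1 n)"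
    have class_z2: "?z2 (y \<otimes> x) = ?z2 (x \<otimes> y)" if "x \<in> carrier G" "y \<in> carrier G" for x y
    proof -
      have eq: "y \<otimes> (x \<otimes> y) \<otimes> inv y = y \<otimes> x" "x \<otimes> (y \<otimes> x) \<otimes> inv x = x \<otimes> y"
        using that by (simp_all add: m_assoc)
      have "y \<otimes> x \<in> B - P_centralizer \<longleftrightarrow> x \<otimes> y \<in> B - P_centralizer"
        using outer_conj[of y "x \<otimes> y"] outer_conj[of x "y \<otimes> x"] that unfolding eq by blast
      then show ?thesis by (simp add: uline_def)
    qed
    have swap: "gr_mult G ?z1 ?w = gr_mult G ?z2 (gr_pow ?z1 (Suc n))"
      unfolding gr_pow_simps gr_mult_assoc[OF fin, symmetric]
      using gr_mult_commute_class_function[of ?z2 ?z1] class_z2 by simp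
    have dvd: "int p dvd gr_mult G ?z2 ?w x"
      by (rule outer_mult_cong_0[OF _ Suc.prems]) (rule outer_mult_invariant)
    have "[gr_pow (uline B) (Suc (Suc n)) x =
        gr_mult G (uline B) (\<lambda>x. gr_pow ?z1 (Suc n) x + int (Suc n) * ?w x) x] (mod int p)"
      unfolding gr_pow_simps(2)[of "uline B" "Suc n"] by (rule gr_mult_cong) (rule Suc.IH)
    also have "gr_mult G (uline B) (\<lambda>x. gr_pow ?z1 (Suc n) x + int (Suc n) * ?w x) x =
        gr_pow ?z1 (Suc (Suc n)) x + int (Suc (Suc n)) * gr_mult G ?z2 (gr_pow ?z1 (Suc n)) x +
        int (Suc n) * gr_mult G ?z2 ?w x"
      unfolding gr_mult_add_scale_right z gr_mult_add_left swap
      unfolding gr_pow_simps(2)[of ?z1 "Suc n"] by (simp add: algebra_simps)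
    also have "[gr_pow ?z1 (Suc (Suc n)) x +
        int (Suc (Suc n)) * gr_mult G ?z2 (gr_pow ?z1 (Suc n)) x + int (Suc n) * gr_mult G ?z2 ?w x =
        gr_pow ?z1 (Suc (Suc n)) x +
        int (Suc (Suc n)) * gr_mult G ?z2 (gr_pow ?z1 (Suc n)) x + 0] (mod int p)"
      using dvd by (intro cong_add cong_refl) (simp add: cong_0_iff)
    finally show ?case by simp
  }
qed

text \<open>At exponent \<open>p\<close> the linear term in the outer part carries the factor
  \<open>p\<close>.\<close>

lemma gr_pow_prime_cong_inner:
  assumes "x \<in> carrier G"
  shows "[gr_pow (uline B) p x = gr_pow (uline (B \<inter> P_centralizer)) p x] (mod int p)"
proof -
  obtain n where n: "p = Suc n" using p_gt_1 by (cases p) auto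
  have "[gr_pow (uline B) p x = gr_pow (uline (B \<inter> P_centralizer)) p x + int p *
      gr_mult G (uline (B - P_centralizer)) (gr_pow (uline (B \<inter> P_centralizer)) n) x] (mod int p)"
    using gr_pow_cong_outer[OF assms, of n] by (simp only: n)
  then show ?thesis by (simp add: cong_def)
qed

lemma list_prod_P_centralizer: "set xs \<subseteq> P_centralizer \<Longrightarrow> list_prod xs \<in> P_centralizer"
  using subgroup_P_centralizer
  by (induction xs) (auto simp: subgroup.m_closed subgroup.one_closed)

text \<open>Elements of the centralizer have classes of size prime to \<open>p\<close>, so the
  rotation count applies to the inner part, which determines the power modulo
  \<open>p\<close>.\<close>

lemma gr_pow_prime_coeff:
  assumes "g \<in> P_centralizer"
  shows "[gr_pow (uline B) p g = int (card {x \<in> B \<inter> P_centralizer. x [^] p = g})] (mod int p)"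
proof -
  have g: "g \<in> carrier G" using assms by simp
  have "[gr_pow (uline (B \<inter> P_centralizer)) p g =
      int (card {x \<in> B \<inter> P_centralizer. x [^] p = g})] (mod int p)"
    by (rule gr_pow_prime_cong[OF fin prime_p _ _ g coprime_card_conj_class[OF assms]])
      (use B B_conj P_centralizer_conj in auto)
  then show ?thesis using gr_pow_prime_cong_inner[OF g] cong_trans by blast
qed

text \<open>Modulo \<open>p\<close> only the inner part matters. Its products stay in the
  centralizer, and there a coefficient not divisible by \<open>p\<close> requires some
  \<open>p\<close>-th root.\<close>

lemma gr_pow_prime_support:
  assumes g: "g \<in> carrier G" "\<not> int p dvd gr_pow (uline B) p g"
  obtains x where "x \<in> P_centralizer" "g = x [^] p"
proof -
  have "g \<in> P_centralizer"
  proof (rule ccontr)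
    assume "g \<notin> P_centralizer"
    then have none: "{xs. length xs = p \<and> set xs \<subseteq> B \<inter> P_centralizer \<and> list_prod xs = g} = {}"
      using list_prod_P_centralizer by auto
    have "B \<inter> P_centralizer \<subseteq> carrier G" using B by auto
    from gr_pow_uline[OF fin this g(1), of p] have "gr_pow (uline (B \<inter> P_centralizer)) p g = 0"
      unfolding none by simp
    then show False using gr_pow_prime_cong_inner[OF g(1)] g(2) by (simp add: cong_0_iff)
  qed
  from gr_pow_prime_coeff[OF this] g(2)
  have "card {x \<in> B \<inter> P_centralizer. x [^] p = g} \<noteq> 0"
    by (metis cong_0_iff of_nat_0)
  then have "{x \<in> B \<inter> P_centralizer. x [^] p = g} \<noteq> {}" by (metis card.empty)
  then show thesis using that by blast
qed

end

text \<open>With \<open>m\<close> the index of \<open>P\<close>, Bezout writes \<open>z\<close> as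
  \<open>(z [^] p) [^] a \<otimes> (z [^] m) [^] b\<close>, where the second factor lies in
  \<open>P\<close>. Equal \<open>p\<close>-th powers thus force \<open>y \<otimes> inv x\<close>
  into \<open>P\<close>; as it commutes with \<open>x\<close>, its \<open>p\<close>-th power is
  trivial.\<close>

lemma P_centralizer_pow_eq:
  assumes xy: "x \<in> P_centralizer" "y \<in> P_centralizer" "y [^] p = x [^] p"
  shows "y \<otimes> inv x \<in> socle"
proof -
  have x: "x \<in> carrier G" and y: "y \<in> carrier G" using xy by auto
  define m where "m = order G div card P"
  obtain a b where "a * int p + b * int m = gcd (int p) (int m)" using bezout_int by blast
  moreover have "gcd (int p) (int m) = 1"
    using coprime_index unfolding m_def by (metis coprime_iff_gcd_eq_1 gcd_int_int_eq of_nat_1)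
  ultimately have ab: "int p * a + int m * b = 1" by (simp add: mult.commute)
  have split: "z = (z [^] p) [^] a \<otimes> (z [^] m) [^] b" if z: "z \<in> carrier G" for z
  proof -
    have "(z [^] p) [^] a \<otimes> (z [^] m) [^] b = z [^] (int p * a) \<otimes> z [^] (int m * b)"
      using z by (metis int_pow_int int_pow_pow)
    also have "\<dots> = z" using z by (simp add: int_pow_mult[symmetric] ab)
    finally show ?thesis by simp
  qed
  define c where "c = (x [^] p) [^] a"
  have c: "c \<in> carrier G" using x by (simp add: c_def)
  have P_int: "u [^] b \<in> P" if "u \<in> P" for u
    using that subgroup_int_pow_closed[OF subgroup_P] by blast
  have xm: "(x [^] m) [^] b \<in> P" and ym: "(y [^] m) [^] b \<in> P"
    using P_int pow_index_in_P x y by (simp_all add: m_def)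
  have "y = c \<otimes> (y [^] m) [^] b" "x = c \<otimes> (x [^] m) [^] b"
    using split[OF y] split[OF x] by (simp_all add: c_def xy(3))
  then have "y \<otimes> inv x = c \<otimes> (y [^] m) [^] b \<otimes> inv (c \<otimes> (x [^] m) [^] b)" by metis
  also have "\<dots> = c \<otimes> ((y [^] m) [^] b \<otimes> inv ((x [^] m) [^] b)) \<otimes> inv c"
    using c P_carrier[OF xm] P_carrier[OF ym] by (simp add: inv_mult_group m_assoc)
  also have "\<dots> \<in> P" using P_conj c xm ym by simp
  finally have u: "y \<otimes> inv x \<in> P" .
  have "y [^] p = (y \<otimes> inv x \<otimes> x) [^] p" using x y by (simp add: m_assoc)
  also have "\<dots> = (y \<otimes> inv x) [^] p \<otimes> x [^] p"
    using P_centralizer_comm[OF xy(1) u] x y by (intro pow_mult_distrib) auto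
  finally have "(y \<otimes> inv x) [^] p \<otimes> x [^] p = \<one> \<otimes> x [^] p" using x by (simp add: xy(3))
  then have "(y \<otimes> inv x) [^] p = \<one>" using x y by (meson inv_closed m_closed nat_pow_closed one_closed right_cancel)
  then show ?thesis using u by (simp add: socle_def)
qed


text \<open>If \<open>P\<close> is central, the transfer \<open>G \<rightarrow> P\<close> composed with \<open>P \<rightarrow> \<int>/p\<close> is a homomorphism which maps \<open>w\<close> to the
  index of \<open>P\<close> modulo \<open>p\<close>, hence is nonzero.\<close>

lemma transfer_mod_p:
  assumes central: "P_centralizer = carrier G"
  obtains V :: "'a \<Rightarrow> int"
  where "\<And>x y. x \<in> carrier G \<Longrightarrow> y \<in> carrier G \<Longrightarrow> [V (x \<otimes> y) = V x + V y] (mod int p)"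
    and "\<not> int p dvd V w"
proof -
  \<comment> \<open>A discrete logarithm to base \<open>w\<close>, chosen among exponents that agree
    modulo \<open>p ^ k\<close>, so it is additive modulo \<open>p\<close>.\<close>
  define l :: "'a \<Rightarrow> int" where "l u = (SOME i. w [^] i = u)" for u
  have l: "w [^] l u = u" if "u \<in> P" for u
  proof -
    have "\<exists>i::int. w [^] i = u" using that by (auto simp: P_eq)
    then show ?thesis unfolding l_def by (rule someI_ex)
  qed
  have l_cong: "[i = j] (mod int p)" if "w [^] i = w [^] j" for i j :: int
  proof -
    have "int p dvd int (p ^ k)" using k_pos by simp
    also have "\<dots> dvd j - i" using that w by (simp add: int_pow_eq ord_w)
    finally show ?thesis by (simp add: cong_iff_dvd_diff dvd_diff_commute)
  qed
  have l_mult: "[l (u \<otimes> v) = l u + l v] (mod int p)" if "u \<in> P" "v \<in> P" for u v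
    by (rule l_cong) (use that w in \<open>simp add: l int_pow_mult[symmetric] int_pow_mult\<close>)
  \<comment> \<open>Choosing from the coset makes \<open>rep\<close> a function of
    \<open>P #> x\<close> alone; below, \<open>t x\<close> is the factor from \<open>P\<close> in
    \<open>x = t x \<otimes> rep x\<close>.\<close>
  define rep where "rep x = (SOME y. y \<in> P #> x)" for x
  have rep: "rep x \<in> P #> x" if "x \<in> carrier G" for x
    unfolding rep_def using rcos_self[OF that subgroup_P] by (rule someI)
  have rep_carrier [simp]: "rep x \<in> carrier G" if "x \<in> carrier G" for x
    using rep[OF that] that r_coset_subset_G[OF P_subset] by blast
  have rep_mult: "rep (u \<otimes> x) = rep x" if "u \<in> P" "x \<in> carrier G" for u x
  proof -
    have "u \<otimes> x \<in> P #> x" using that by (auto simp: r_coset_def)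
    then have "P #> (u \<otimes> x) = P #> x" using that subgroup_P by (metis repr_independence)
    then show ?thesis by (simp add: rep_def)
  qed
  define t where "t x = x \<otimes> inv (rep x)" for x
  have t: "t x \<in> P" if x: "x \<in> carrier G" for x
  proof -
    obtain u where u: "u \<in> P" "rep x = u \<otimes> x" using rep[OF x] by (auto simp: r_coset_def)
    then have "t x = inv u" using x by (simp add: t_def inv_mult_group)
    then show ?thesis using u by simp
  qed
  have t_rep: "t x \<otimes> rep x = x" if "x \<in> carrier G" for x
    using that by (simp add: t_def m_assoc)
  have t_mult: "t (u \<otimes> x) = u \<otimes> t x" if "u \<in> P" "x \<in> carrier G" for u x
    using that by (simp add: t_def rep_mult m_assoc)
  define R where "R = rep ` carrier G"
  have R: "r \<in> carrier G" if "r \<in> R" for r using that by (auto simp: R_def)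
  have finR: "finite R" using fin by (simp add: R_def)
  have rep_R: "rep r = r" if r: "r \<in> R" for r
  proof -
    obtain x where x: "x \<in> carrier G" "r = rep x" using r by (auto simp: R_def)
    then obtain u where "u \<in> P" "rep x = u \<otimes> x" using rep[OF x(1)] by (auto simp: r_coset_def)
    then show ?thesis using x rep_mult by metis
  qed
  \<comment> \<open>The transfer in additive form: the product over coset representatives becomes a
    sum of logarithms.\<close>
  define V where "V g = (\<Sum>r\<in>R. l (t (r \<otimes> g)))" for g
  have "[V (g \<otimes> h) = V g + V h] (mod int p)" if g: "g \<in> carrier G" and h: "h \<in> carrier G" for g h
  proof -
    have step: "[l (t (r \<otimes> (g \<otimes> h))) = l (t (r \<otimes> g)) + l (t (rep (r \<otimes> g) \<otimes> h))] (mod int p)"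
      if r: "r \<in> R" for r
    proof -
      have rg: "r \<otimes> g \<in> carrier G" using R r g by simp
      have "r \<otimes> (g \<otimes> h) = t (r \<otimes> g) \<otimes> rep (r \<otimes> g) \<otimes> h"
        using t_rep[OF rg] R r g h by (simp add: m_assoc)
      also have "\<dots> = t (r \<otimes> g) \<otimes> (rep (r \<otimes> g) \<otimes> h)"
        using t[OF rg] rg h by (simp add: m_assoc)
      finally have "t (r \<otimes> (g \<otimes> h)) = t (r \<otimes> g) \<otimes> t (rep (r \<otimes> g) \<otimes> h)"
        using t[OF rg] rg h by (simp add: t_mult)
      then show ?thesis using l_mult t rg h by simp
    qed
    \<comment> \<open>Right multiplication by \<open>g\<close> permutes the cosets, so the second
      summands in \<open>step\<close> add up to \<open>V h\<close>.\<close>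
    have inj: "inj_on (\<lambda>r. rep (r \<otimes> g)) R"
    proof (rule inj_onI)
      fix r s assume rs: "r \<in> R" "s \<in> R" "rep (r \<otimes> g) = rep (s \<otimes> g)"
      have c: "r \<otimes> g \<in> carrier G" "s \<otimes> g \<in> carrier G" using R rs g by auto
      define u where "u = t (r \<otimes> g) \<otimes> inv (t (s \<otimes> g))"
      have u: "u \<in> P" using t c by (simp add: u_def)
      have "r \<otimes> g = u \<otimes> (s \<otimes> g)"
        using t_rep[OF c(1)] t_rep[OF c(2)] rs(3) t[OF c(1)] t[OF c(2)] c
        by (metis (no_types, lifting) P_carrier inv_closed inv_solve_left m_assoc rep_carrier u_def)
      then have "r = u \<otimes> s" using R rs g u
        by (metis P_carrier m_assoc m_closed right_cancel)
      then show "r = s" using rep_mult[OF u, of s] rep_R rs R by metis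
    qed
    have "(\<lambda>r. rep (r \<otimes> g)) ` R = R"
      by (rule card_subset_eq[OF finR]) (use R g card_image[OF inj] in \<open>auto simp: R_def\<close>)
    then have perm: "(\<Sum>r\<in>R. l (t (rep (r \<otimes> g) \<otimes> h))) = V h"
      using sum.reindex[OF inj, of "\<lambda>r. l (t (r \<otimes> h))"] by (simp add: V_def)
    have "[V (g \<otimes> h) = (\<Sum>r\<in>R. l (t (r \<otimes> g)) + l (t (rep (r \<otimes> g) \<otimes> h)))] (mod int p)"
      unfolding V_def using step by (intro cong_sum)
    then show ?thesis by (simp add: sum.distrib perm) (simp add: V_def)
  qed
  moreover have "\<not> int p dvd V w"
  proof
    assume dvd: "int p dvd V w"
    have wP: "w \<in> P" unfolding P_eq using w by (metis int_pow_1 rangeI)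
    have "[l w = 1] (mod int p)" by (rule l_cong) (use l wP w in auto)
    \<comment> \<open>As \<open>w\<close> is central, every representative contributes
      \<open>w\<close> itself, so \<open>V w\<close> is the index times \<open>l w\<close>.\<close>
    have "t (r \<otimes> w) = w" if "r \<in> R" for r
    proof -
      have r: "r \<in> carrier G" "rep r = r" using R rep_R that by auto
      have "r \<otimes> w = w \<otimes> r" using P_centralizer_comm[OF _ wP] r central by auto
      then have "t (r \<otimes> w) = w \<otimes> t r" using t_mult wP r by simp
      then show ?thesis using r w by (simp add: t_def)
    qed
    then have "V w = int (card R) * l w" by (simp add: V_def)
    then have "int p dvd int (card R)"
      using dvd \<open>[l w = 1] (mod int p)\<close> prime_p
      by (metis cong_dvd_iff not_prime_unit prime_dvd_mult_iff prime_nat_int_transfer)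
    then have pR: "p dvd card R" by simp
    have "bij_betw (\<lambda>r. P #> r) R (rcosets P)"
    proof (rule bij_betwI')
      fix r s assume rs: "r \<in> R" "s \<in> R"
      show "(P #> r = P #> s) = (r = s)"
        using rep_R[OF rs(1)] rep_R[OF rs(2)] by (metis rep_def)
    next
      fix r assume "r \<in> R" then show "P #> r \<in> rcosets P" using R rcosetsI[OF P_subset] by blast
    next
      fix C assume "C \<in> rcosets P"
      then obtain x where x: "x \<in> carrier G" "C = P #> x" by (auto simp: RCOSETS_def)
      then have "C = P #> rep x" using rep[OF x(1)] subgroup_P by (metis repr_independence)
      then show "\<exists>r\<in>R. C = P #> r" using x by (auto simp: R_def)
    qed
    then have "card R * card P = order G"
      using lagrange[OF subgroup_P] by (simp add: bij_betw_same_card)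
    then have "card R = order G div card P" using card_P p_gt_1
      by (metis nonzero_mult_div_cancel_right power_not_zero not_one_less_zero)
    then have "coprime p (card R)" using coprime_index by simp
    then show False using pR p_gt_1 by (metis coprime_absorb_left less_irrefl nat_dvd_1_iff_1)
  qed
  ultimately show thesis by (rule that)
qed

text \<open>A noncentral \<open>P\<close> has a proper centralizer. Otherwise the kernel of the
  transfer modulo \<open>p\<close> serves: it omits \<open>w\<close> and contains all
  \<open>p\<close>-th powers. The subgroup \<open>H\<close> traps the support of \<open>p\<close>-th
  powers of basic sets.\<close>

lemma powers_in_proper_subgroup:
  obtains H where "subgroup H G" "H \<noteq> carrier G" "\<And>x. x \<in> P_centralizer \<Longrightarrow> x [^] p \<in> H"
proof (cases "P_centralizer = carrier G")
  case False
  have "x [^] p \<in> P_centralizer" if "x \<in> P_centralizer" for x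
    using that subgroup_P_centralizer
    by (induction p) (auto simp: subgroup.m_closed subgroup.one_closed)
  then show thesis using False that subgroup_P_centralizer by blast
next
  case True
  obtain V :: "'a \<Rightarrow> int"
    where V: "\<And>x y. x \<in> carrier G \<Longrightarrow> y \<in> carrier G \<Longrightarrow> [V (x \<otimes> y) = V x + V y] (mod int p)"
      and Vw: "\<not> int p dvd V w"
    using transfer_mod_p[OF True] by blast
  have "[V (\<one> \<otimes> \<one>) = V \<one> + V \<one>] (mod int p)" by (rule V) auto
  then have V1: "int p dvd V \<one>" by (simp add: cong_iff_dvd_diff)
  have V_pow: "[V (x [^] n) = int n * V x] (mod int p)" if x: "x \<in> carrier G" for x and n :: nat
  proof (induction n)
    case 0
    then show ?case using V1 by (simp add: cong_0_iff)
  next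
    case (Suc n)
    have "[V (x [^] Suc n) = V (x [^] n) + V x] (mod int p)" using V x by simp
    also have "[V (x [^] n) + V x = int n * V x + V x] (mod int p)"
      by (rule cong_add[OF Suc.IH cong_refl])
    finally show ?case by (simp add: algebra_simps)
  qed
  let ?H = "{x \<in> carrier G. int p dvd V x}"
  have "subgroup ?H G"
  proof (rule subgroupI)
    show "?H \<noteq> {}" using V1 by blast
    fix a assume a: "a \<in> ?H"
    then have "[V \<one> = V a + V (inv a)] (mod int p)" using V[of a "inv a"] by simp
    then have "int p dvd V a + V (inv a)" using V1 cong_dvd_iff by blast
    then show "inv a \<in> ?H" using a by (simp add: dvd_add_right_iff)
  next
    fix a b assume "a \<in> ?H" "b \<in> ?H"
    then show "a \<otimes> b \<in> ?H" using cong_dvd_iff[OF V[of a b]] by auto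
  qed auto
  moreover have "?H \<noteq> carrier G" using Vw w by blast
  moreover have "x [^] p \<in> ?H" if "x \<in> P_centralizer" for x
    using cong_dvd_iff[OF V_pow[of x p]] that by simp
  ultimately show thesis by (rule that)
qed

end

section \<open>Schur partitions\<close>

lemma zspan_coeff:
  assumes "finite S" "\<forall>B\<in>S. \<forall>Y\<in>S. B \<noteq> Y \<longrightarrow> B \<inter> Y = {}" "D \<in> S" "x \<in> D"
  shows "(\<Sum>B\<in>S. c B * uline B x) = c D"
proof -
  have "(\<Sum>B\<in>S. c B * uline B x) = (\<Sum>B\<in>S. if B = D then c D else 0)"
    using assms(2-4) by (intro sum.cong) (auto simp: uline_def)
  then show ?thesis using assms(1,3) by simp
qed

lemma mem_zspan_iff:
  assumes "finite S" "\<forall>B\<in>S. \<forall>Y\<in>S. B \<noteq> Y \<longrightarrow> B \<inter> Y = {}" "{} \<notin> S"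
  shows "f \<in> zspan S \<longleftrightarrow> (\<forall>x. x \<notin> \<Union>S \<longrightarrow> f x = 0) \<and> (\<forall>D\<in>S. \<forall>x\<in>D. \<forall>y\<in>D. f x = f y)"
proof
  assume "f \<in> zspan S"
  then obtain c where f: "f = (\<lambda>x. \<Sum>B\<in>S. c B * uline B x)" by (auto simp: zspan_def)
  have "f x = 0" if "x \<notin> \<Union>S" for x
    unfolding f using that by (intro sum.neutral) (auto simp: uline_def)
  moreover have "f x = c D" if "D \<in> S" "x \<in> D" for x D
    unfolding f by (rule zspan_coeff[OF assms(1,2) that])
  ultimately show "(\<forall>x. x \<notin> \<Union>S \<longrightarrow> f x = 0) \<and> (\<forall>D\<in>S. \<forall>x\<in>D. \<forall>y\<in>D. f x = f y)" by metis
next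
  assume f: "(\<forall>x. x \<notin> \<Union>S \<longrightarrow> f x = 0) \<and> (\<forall>D\<in>S. \<forall>x\<in>D. \<forall>y\<in>D. f x = f y)"
  \<comment> \<open>When \<open>f\<close> is constant on each member of \<open>S\<close>, its value
    at a chosen point is the coefficient of that member.\<close>
  define c where "c D = f (SOME x. x \<in> D)" for D
  have "f x = (\<Sum>B\<in>S. c B * uline B x)" for x
  proof (cases "x \<in> \<Union>S")
    case True
    then obtain D where D: "D \<in> S" "x \<in> D" by auto
    then have "(SOME x. x \<in> D) \<in> D" by (metis someI)
    then have "f x = c D" unfolding c_def using f D by blast
    then show ?thesis using zspan_coeff[OF assms(1,2) D] by simp
  next
    case False
    then have "(\<Sum>B\<in>S. c B * uline B x) = 0" by (intro sum.neutral) (auto simp: uline_def)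
    then show ?thesis using False f by simp
  qed
  then show "f \<in> zspan S" by (auto simp: zspan_def)
qed

locale schur_partition = group +
  fixes S :: "'a set set"
  assumes finite_carrier: "finite (carrier G)" and schur: "is_schur_partition G S"
begin

lemma S_Union: "\<Union>S = carrier G"
  and S_nonempty: "D \<in> S \<Longrightarrow> D \<noteq> {}"
  and S_disjoint: "D \<in> S \<Longrightarrow> Y \<in> S \<Longrightarrow> x \<in> D \<Longrightarrow> x \<in> Y \<Longrightarrow> D = Y"
  and S_one: "{\<one>} \<in> S"
  and S_inv: "D \<in> S \<Longrightarrow> m_inv G ` D \<in> S"
  and zspan_mult: "f \<in> zspan S \<Longrightarrow> g \<in> zspan S \<Longrightarrow> gr_mult G f g \<in> zspan S"
  using schur unfolding is_schur_partition_def by blast+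

lemma S_subset: "D \<in> S \<Longrightarrow> D \<subseteq> carrier G"
  using S_Union by blast

lemma S_carrier: "D \<in> S \<Longrightarrow> x \<in> D \<Longrightarrow> x \<in> carrier G"
  using S_Union by blast

lemma finite_S: "finite S"
  using finite_carrier S_Union finite_UnionD by metis

lemma zspan_iff:
  "f \<in> zspan S \<longleftrightarrow> (\<forall>x. x \<notin> carrier G \<longrightarrow> f x = 0) \<and> (\<forall>D\<in>S. \<forall>x\<in>D. \<forall>y\<in>D. f x = f y)"
proof -
  have "\<forall>B\<in>S. \<forall>Y\<in>S. B \<noteq> Y \<longrightarrow> B \<inter> Y = {}" "{} \<notin> S"
    using S_disjoint S_nonempty by blast+
  then show ?thesis using mem_zspan_iff[OF finite_S] S_Union by simp
qed

lemma uline_mem_zspan_iff: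
  "uline B \<in> zspan S \<longleftrightarrow> B \<subseteq> carrier G \<and> (\<forall>D\<in>S. D \<subseteq> B \<or> D \<inter> B = {})"
  unfolding zspan_iff uline_def by (auto split: if_splits)

lemma uline_basic: "D \<in> S \<Longrightarrow> uline D \<in> zspan S"
  unfolding uline_mem_zspan_iff using S_disjoint S_subset by blast

text \<open>The Schur-Wielandt principle: elements of the span are constant on basic sets, so any
  condition on coefficients cuts out a union of basic sets.\<close>

lemma level_set:
  assumes "f \<in> zspan S"
  shows "uline {x \<in> carrier G. Q (f x)} \<in> zspan S"
  unfolding uline_mem_zspan_iff
proof (intro conjI ballI)
  fix D assume D: "D \<in> S"
  have "f x = f y" if "x \<in> D" "y \<in> D" for x y
    using assms that D unfolding zspan_iff by blast
  then show "D \<subseteq> {x \<in> carrier G. Q (f x)} \<or> D \<inter> {x \<in> carrier G. Q (f x)} = {}"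
    using S_subset[OF D] by (smt (verit) disjoint_iff mem_Collect_eq subset_iff)
qed auto

lemma gr_pow_zspan: "f \<in> zspan S \<Longrightarrow> gr_pow f n \<in> zspan S"
  by (induction n) (auto simp: zspan_mult uline_basic S_one)

text \<open>Overlapping members of the two partitions contain each other, since each indicator
  function lies in both spans. This makes the description in \<open>basic_sets\<close> denote
  \<open>S\<close>.\<close>

lemma schur_partition_unique:
  assumes "is_schur_partition G S'" "zspan S' = zspan S"
  shows "S' = S"
proof -
  interpret S': schur_partition G S'
    by unfold_locales (use finite_carrier assms in auto)
  have sub: "D \<in> T'" if "D \<in> T" "schur_partition G T" "schur_partition G T'" "zspan T = zspan T'"
    for D T T'
  proof -
    interpret T: schur_partition G T by fact
    interpret T': schur_partition G T' by fact
    obtain x where x: "x \<in> D" using T.S_nonempty \<open>D \<in> T\<close> by blast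
    then obtain Y where Y: "Y \<in> T'" "x \<in> Y" using T.S_carrier[OF \<open>D \<in> T\<close>] T'.S_Union by blast
    have "uline D \<in> zspan T'" "uline Y \<in> zspan T"
      using T.uline_basic T'.uline_basic Y(1) that by auto
    then have "D = Y"
      unfolding T.uline_mem_zspan_iff T'.uline_mem_zspan_iff using x Y that(1) by blast
    then show ?thesis using Y by simp
  qed
  have "schur_partition G S" "schur_partition G S'" by unfold_locales
  then show ?thesis using sub assms(2) by blast
qed

lemma basic_sets_zspan: "basic_sets G (zspan S) = S"
  unfolding basic_sets_def
proof (rule the_equality)
  show "is_schur_partition G S \<and> zspan S = zspan S" using schur by simp
  show "S' = S" if "is_schur_partition G S' \<and> zspan S = zspan S'" for S'
    using schur_partition_unique[of S'] that by simp
qed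

lemma A_set_iff: "A_set G (zspan S) B \<longleftrightarrow> uline B \<in> zspan S"
proof
  assume "A_set G (zspan S) B"
  then obtain T where "T \<subseteq> S" "B = \<Union>T" by (auto simp: A_set_def basic_sets_zspan)
  then show "uline B \<in> zspan S"
    unfolding uline_mem_zspan_iff using S_subset S_disjoint by blast
next
  assume "uline B \<in> zspan S"
  then have B: "B \<subseteq> \<Union>S" "\<forall>D\<in>S. D \<subseteq> B \<or> D \<inter> B = {}"
    by (auto simp: uline_mem_zspan_iff S_Union)
  have "B = \<Union>{D\<in>S. D \<subseteq> B}"
  proof (intro equalityI subsetI)
    fix x assume x: "x \<in> B"
    then obtain D where D: "D \<in> S" "x \<in> D" using B(1) by blast
    then have "D \<inter> B \<noteq> {}" using x by blast
    then show "x \<in> \<Union>{D\<in>S. D \<subseteq> B}" using B(2) D by blast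
  qed blast
  then show "A_set G (zspan S) B"
    unfolding A_set_def basic_sets_zspan by (intro exI[of _ "{D\<in>S. D \<subseteq> B}"]) auto
qed

text \<open>Coefficients of the product of \<open>D\<close> with its inverse measure how far
  \<open>D\<close> overlaps its left translate by \<open>g\<close>.\<close>

lemma mult_inv_apply:
  assumes D: "D \<in> S" and g: "g \<in> carrier G"
  shows "gr_mult G (uline D) (uline (m_inv G ` D)) g = int (card {y\<in>D. inv g \<otimes> y \<in> D})"
proof -
  have "inv y \<otimes> g \<in> m_inv G ` D \<longleftrightarrow> inv g \<otimes> y \<in> D" if "y \<in> D" for y
  proof -
    have y: "y \<in> carrier G" using that D S_carrier by blast
    have "inv y \<otimes> g = inv (inv g \<otimes> y)" using g y by (simp add: inv_mult_group)
    moreover have "inv (inv y \<otimes> g) = inv g \<otimes> y" using g y by (simp add: inv_mult_group)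
    moreover have "inv g \<otimes> y \<in> carrier G" using g y by simp
    ultimately show ?thesis using S_carrier[OF D] by (auto simp: image_iff)
  qed
  then have "{y\<in>D. inv y \<otimes> g \<in> m_inv G ` D} = {y\<in>D. inv g \<otimes> y \<in> D}" by blast
  then show ?thesis
    using gr_mult_uline_uline[OF finite_carrier g S_subset[OF D]] by simp
qed

end

section \<open>Consequences of primitivity\<close>

locale primitive_schur_partition = schur_partition +
  assumes prim: "\<And>H. subgroup H G \<Longrightarrow> uline H \<in> zspan S \<Longrightarrow> H = {\<one>} \<or> H = carrier G"
begin

text \<open>The largest A-set between \<open>insert \<one> T\<close> and \<open>H\<close> is a subgroup.\<close>

lemma A_set_in_proper_subgroup:
  assumes T: "uline T \<in> zspan S" "T \<subseteq> H" and H: "subgroup H G" "H \<noteq> carrier G"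
  shows "T \<subseteq> {\<one>}"
proof -
  define F where "F = {B. uline B \<in> zspan S \<and> insert \<one> T \<subseteq> B \<and> B \<subseteq> H}"
  have H_sub: "H \<subseteq> carrier G" using H(1) subgroup.subset by blast
  have finF: "finite F"
    by (rule finite_subset[of _ "Pow (carrier G)"]) (use H_sub finite_carrier in \<open>auto simp: F_def\<close>)
  have "uline (insert \<one> T) \<in> zspan S"
    unfolding uline_mem_zspan_iff
  proof (intro conjI ballI)
    show "insert \<one> T \<subseteq> carrier G" using T(2) H_sub by auto
    fix D assume D: "D \<in> S"
    show "D \<subseteq> insert \<one> T \<or> D \<inter> insert \<one> T = {}"
    proof (cases "\<one> \<in> D")
      case True
      then have "D = {\<one>}" using S_disjoint[OF D S_one] by blast
      then show ?thesis by simp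
    next
      case False
      then show ?thesis using T(1) D unfolding uline_mem_zspan_iff by blast
    qed
  qed
  then have "insert \<one> T \<in> F"
    using T(2) subgroup.one_closed[OF H(1)] by (auto simp: F_def)
  then obtain B where B: "B \<in> F" and max: "\<And>C. C \<in> F \<Longrightarrow> B \<subseteq> C \<Longrightarrow> B = C"
    using finite_has_maximal[OF finF] by blast
  have B_sub: "B \<subseteq> carrier G" using B H_sub by (auto simp: F_def)
  have one_B: "\<one> \<in> B" using B by (auto simp: F_def)
  \<comment> \<open>The support of the square of \<open>B\<close> is the product set
    \<open>B B\<close>; it is again a union of basic sets inside \<open>H\<close>, so maximality
    forces \<open>B B = B\<close>.\<close>
  define C where "C = {x \<in> carrier G. gr_mult G (uline B) (uline B) x \<noteq> 0}"
  have C: "x \<in> C \<longleftrightarrow> (\<exists>y\<in>B. inv y \<otimes> x \<in> B)" if "x \<in> carrier G" for x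
  proof -
    have "finite {y\<in>B. inv y \<otimes> x \<in> B}"
      by (rule finite_subset[OF _ finite_carrier]) (use B_sub in blast)
    then show ?thesis
      using that by (auto simp: C_def gr_mult_uline_uline[OF finite_carrier that B_sub] card_eq_0_iff)
  qed
  have BC: "B \<subseteq> C"
  proof
    fix x assume x: "x \<in> B"
    then have "x \<in> carrier G" "inv \<one> \<otimes> x \<in> B" using B_sub by auto
    then show "x \<in> C" using C one_B by blast
  qed
  have "C \<subseteq> H"
  proof
    fix x assume x: "x \<in> C"
    then have xc: "x \<in> carrier G" by (simp add: C_def)
    then obtain y where "y \<in> B" "inv y \<otimes> x \<in> B" using C x by blast
    then have "y \<in> H" "inv y \<otimes> x \<in> H" using B by (auto simp: F_def)
    then have "y \<otimes> (inv y \<otimes> x) \<in> H" by (rule subgroup.m_closed[OF H(1)])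
    moreover have "y \<in> carrier G" using \<open>y \<in> H\<close> H_sub by blast
    ultimately show "x \<in> H" using xc by simp
  qed
  moreover have "uline C \<in> zspan S"
    unfolding C_def using B by (intro level_set zspan_mult) (auto simp: F_def)
  ultimately have "C \<in> F" using BC B unfolding F_def by blast
  then have "B = C" using max BC by blast
  then have mult: "x \<otimes> y \<in> B" if "x \<in> B" "y \<in> B" for x y
    using C[of "x \<otimes> y"] that B_sub by (auto simp: subset_iff)
  have "subgroup B G"
  proof (rule subgroupI)
    fix a assume a: "a \<in> B"
    then have ac: "a \<in> carrier G" using B_sub by blast
    have pow: "a [^] n \<in> B" for n :: nat
      using a one_B mult by (induction n) auto
    have "order G > 0" using finite_carrier by (simp add: order_gt_0_iff_finite)
    then have "a [^] (order G - 1) \<otimes> a = \<one>"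
      using pow_order_eq_1[OF ac] nat_pow_Suc[of a "order G - 1"] by simp
    then have "inv a = a [^] (order G - 1)" using ac by (simp add: inv_equality)
    then show "inv a \<in> B" using pow by simp
  qed (use mult B_sub one_B in auto)
  then have "B = {\<one>} \<or> B = carrier G" using prim B by (auto simp: F_def)
  then have "B = {\<one>}" using B H(2) H_sub by (auto simp: F_def)
  then show ?thesis using B by (auto simp: F_def)
qed

text \<open>The left stabilizer \<open>H\<close> of \<open>D\<close> is where the coefficient of
  \<open>D\<close> times its inverse equals \<open>card D\<close>, so it is a union of basic sets.
  It contains \<open>inv v\<close>, hence is all of \<open>G\<close> by primitivity; then
  \<open>D\<close> is everything and meets the basic set \<open>{\<one>}\<close>.\<close>

lemma basic_set_no_translation:
  assumes D: "D \<in> S" and v: "v \<in> carrier G" "v \<noteq> \<one>" "\<And>x. x \<in> D \<Longrightarrow> v \<otimes> x \<in> D"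
  shows False
proof -
  have finX: "finite D" using S_subset[OF D] finite_carrier finite_subset by blast
  define H where "H = {g \<in> carrier G. \<forall>y\<in>D. inv g \<otimes> y \<in> D}"
  let ?c = "gr_mult G (uline D) (uline (m_inv G ` D))"
  have "?c g = int (card D) \<longleftrightarrow> (\<forall>y\<in>D. inv g \<otimes> y \<in> D)" if g: "g \<in> carrier G" for g
  proof
    assume "?c g = int (card D)"
    then have "card {y\<in>D. inv g \<otimes> y \<in> D} = card D" using mult_inv_apply[OF D g] by simp
    then have "{y\<in>D. inv g \<otimes> y \<in> D} = D" by (intro card_subset_eq finX) auto
    then show "\<forall>y\<in>D. inv g \<otimes> y \<in> D" by blast
  next
    assume "\<forall>y\<in>D. inv g \<otimes> y \<in> D"
    then have "{y\<in>D. inv g \<otimes> y \<in> D} = D" by blast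
    then show "?c g = int (card D)" using mult_inv_apply[OF D g] by simp
  qed
  then have "H = {g \<in> carrier G. ?c g = int (card D)}" by (auto simp: H_def)
  then have uH: "uline H \<in> zspan S"
    using level_set[of ?c "\<lambda>n. n = int (card D)"] zspan_mult uline_basic D S_inv by simp
  have translate: "g \<otimes> y \<in> D" if g: "g \<in> carrier G" "\<forall>y\<in>D. inv g \<otimes> y \<in> D" and y: "y \<in> D" for g y
  proof -
    have "inj_on (\<lambda>y. inv g \<otimes> y) D"
      by (rule inj_onI) (use g S_carrier[OF D] in simp)
    then have "(\<lambda>y. inv g \<otimes> y) ` D = D"
      using g by (intro endo_inj_surj finX) auto
    then obtain z where "z \<in> D" "y = inv g \<otimes> z" using y by blast
    then show ?thesis using g S_carrier[OF D] by simp
  qed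
  have "subgroup H G"
  proof (rule subgroupI)
    have "\<one> \<in> H" using S_carrier[OF D] by (simp add: H_def)
    then show "H \<noteq> {}" by blast
    fix a assume "a \<in> H" then show "inv a \<in> H" using translate by (simp add: H_def)
  next
    fix a b assume ab: "a \<in> H" "b \<in> H"
    then have "inv (a \<otimes> b) \<otimes> y = inv b \<otimes> (inv a \<otimes> y)" if "y \<in> D" for y
      using that S_carrier[OF D] by (simp add: H_def inv_mult_group m_assoc)
    then show "a \<otimes> b \<in> H" using ab by (auto simp: H_def)
  qed (auto simp: H_def)
  moreover have "inv v \<in> H" using v by (simp add: H_def)
  moreover have "inv v \<noteq> \<one>" using v by simp
  ultimately have "H = carrier G" using prim uH by blast
  obtain x where x: "x \<in> D" using S_nonempty D by blast
  have "y \<in> D" if y: "y \<in> carrier G" for y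
  proof -
    have "x \<otimes> inv y \<in> H" using \<open>H = carrier G\<close> S_carrier[OF D x] y by simp
    then have "inv (x \<otimes> inv y) \<otimes> x \<in> D" using x by (simp add: H_def)
    then show ?thesis using S_carrier[OF D x] y by (simp add: inv_mult_group m_assoc)
  qed
  then have "\<one> \<in> D" "v \<in> D" using v by auto
  then show False using S_disjoint[OF D S_one, of \<one>] v by auto
qed

end

section \<open>Central primitive S-rings\<close>

locale central_primitive_sring =
  normal_cyclic_sylow G p k P w + primitive_schur_partition G S
  for G (structure) and p k P w S +
  assumes central: "central_sring G (zspan S)"
    and not_prime_order: "\<not> Factorial_Ring.prime (order G)"
begin

text \<open>Centrality gives \<open>D h = h D\<close> in the group ring; compare coefficients at
  \<open>h \<otimes> x\<close>.\<close>

lemma S_conj: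
  assumes D: "D \<in> S" "x \<in> D" and h: "h \<in> carrier G"
  shows "h \<otimes> x \<otimes> inv h \<in> D"
proof -
  have x: "x \<in> carrier G" using D S_carrier by blast
  have "uline {h} \<in> group_ring G" using h by (simp add: group_ring_def uline_def)
  then have comm: "gr_mult G (uline D) (uline {h}) = gr_mult G (uline {h}) (uline D)"
    using central uline_basic[OF D(1)] unfolding central_sring_def by blast
  have "gr_mult G (uline {h}) (uline D) (h \<otimes> x) = (\<Sum>y\<in>{h}. uline D (inv y \<otimes> (h \<otimes> x)))"
    by (rule gr_mult_uline[OF fin]) (use h x in auto)
  also have "\<dots> = 1" using h x D by (simp add: uline_def)
  finally have "int (card {y\<in>D. inv y \<otimes> (h \<otimes> x) \<in> {h}}) = 1"
    using gr_mult_uline_uline[OF fin _ S_subset[OF D(1)], of "h \<otimes> x" "{h}"] h x comm by simp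
  then have "{y\<in>D. inv y \<otimes> (h \<otimes> x) \<in> {h}} \<noteq> {}" by (metis card.empty of_nat_0 zero_neq_one)
  then obtain y where y: "y \<in> D" "inv y \<otimes> (h \<otimes> x) = h" by blast
  have yc: "y \<in> carrier G" using y D(1) S_carrier by blast
  have "h \<otimes> x = y \<otimes> (inv y \<otimes> (h \<otimes> x))" using yc h x by simp
  then have "h \<otimes> x = y \<otimes> h" by (simp only: y(2))
  then have "h \<otimes> x \<otimes> inv h = y" using yc h by (simp add: m_assoc)
  then show ?thesis using y by simp
qed

text \<open>For \<open>x\<close> in the centralizer, primitivity makes the coefficient of the
  \<open>p\<close>-th power of \<open>D\<close> at \<open>x [^] p\<close> divisible by
  \<open>p\<close>. Modulo \<open>p\<close> it counts the roots of \<open>x [^] p\<close> in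
  \<open>D \<inter> P_centralizer\<close>; these lie in a socle coset of size \<open>p\<close> and
  include \<open>x\<close>, so they fill the coset.\<close>

lemma socle_mult_basic:
  assumes D: "D \<in> S" and x: "x \<in> D" "x \<notin> socle" and u: "u \<in> socle"
  shows "u \<otimes> x \<in> D"
proof (cases "x \<in> P_centralizer")
  case False
  then show ?thesis
    using outer_socle_mult[OF S_subset[OF D] S_conj[OF D]] x u by blast
next
  case True
  define T where "T = {g \<in> carrier G. \<not> int p dvd gr_pow (uline D) p g}"
  have T: "uline T \<in> zspan S"
    unfolding T_def by (intro level_set gr_pow_zspan uline_basic D)
  obtain H where H: "subgroup H G" "H \<noteq> carrier G" "\<And>x. x \<in> P_centralizer \<Longrightarrow> x [^] p \<in> H"
    using powers_in_proper_subgroup by blast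
  have "T \<subseteq> H"
  proof
    fix g assume "g \<in> T"
    then have "g \<in> carrier G" "\<not> int p dvd gr_pow (uline D) p g" by (auto simp: T_def)
    then obtain y where "y \<in> P_centralizer" "g = y [^] p"
      using gr_pow_prime_support[OF S_subset[OF D] S_conj[OF D]] by blast
    then show "g \<in> H" using H(3) by simp
  qed
  then have T1: "T \<subseteq> {\<one>}" using A_set_in_proper_subgroup T H(1,2) by blast
  have xc: "x \<in> carrier G" using True by simp
  have one: "\<one> \<in> P_centralizer" using P_P_centralizer by auto
  \<comment> \<open>Otherwise \<open>x\<close> and \<open>\<one>\<close> would have the same
    \<open>p\<close>-th power, which would put \<open>x\<close> into the socle.\<close>
  have "x [^] p \<noteq> \<one>" using P_centralizer_pow_eq[OF one True] x(2) xc by auto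
  then have "x [^] p \<notin> T" using T1 by blast
  then have dvd: "int p dvd gr_pow (uline D) p (x [^] p)" using xc by (simp add: T_def)
  have xp: "x [^] p \<in> P_centralizer"
    using True subgroup_P_centralizer by (induction p) (auto simp: subgroup.m_closed one)
  let ?E = "{y \<in> D \<inter> P_centralizer. y [^] p = x [^] p}"
  have "int p dvd int (card ?E)"
    using dvd cong_dvd_iff[OF gr_pow_prime_coeff[OF S_subset[OF D] S_conj[OF D] xp]] by blast
  then have p_card: "p dvd card ?E" by simp
  have sub: "?E \<subseteq> (\<lambda>u. u \<otimes> x) ` socle"
  proof
    fix y assume y: "y \<in> ?E"
    then have "y \<otimes> inv x \<in> socle" using P_centralizer_pow_eq[OF True] by auto
    moreover have "y = (y \<otimes> inv x) \<otimes> x" using y xc by (simp add: m_assoc)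
    ultimately show "y \<in> (\<lambda>u. u \<otimes> x) ` socle" by blast
  qed
  have fin_im: "finite ((\<lambda>u. u \<otimes> x) ` socle)" using finite_socle by simp
  have card_im: "card ((\<lambda>u. u \<otimes> x) ` socle) \<le> p"
    using card_image_le[OF finite_socle] card_socle by metis
  have "x \<in> ?E" using x True by simp
  then have "card ?E \<noteq> 0" unfolding card_eq_0_iff using finite_subset[OF sub fin_im] by blast
  then have "card ?E \<ge> p" using p_card by (simp add: dvd_imp_le)
  then have "?E = (\<lambda>u. u \<otimes> x) ` socle"
    using card_im by (intro card_seteq[OF fin_im sub]) linarith
  then show ?thesis using u by blast
qed

text \<open>Compositeness of the group order enters here: the socle has prime order.\<close>

lemma socle_proper: "socle \<noteq> carrier G"
  using card_socle not_prime_order prime_p by (metis order_def)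

text \<open>Otherwise a nontrivial socle element would translate all of \<open>D\<close> into
  itself.\<close>

lemma basic_meets_socle:
  assumes D: "D \<in> S" shows "D \<inter> socle \<noteq> {}"
proof
  assume empty: "D \<inter> socle = {}"
  have "socle \<noteq> {\<one>}" using card_socle p_gt_1 by auto
  then obtain v where v: "v \<in> socle" "v \<noteq> \<one>" using one_in_socle by blast
  have "v \<otimes> x \<in> D" if "x \<in> D" for x using socle_mult_basic[OF D that] empty that v(1) by blast
  then show False by (rule basic_set_no_translation[OF D socle_carrier[OF v(1)] v(2)])
qed

text \<open>With \<open>n = |D \<inter> socle|\<close>, the coefficient of \<open>D D\<inverse>\<close> is congruent modulo \<open>p\<close> to a number below \<open>n\<close>
  at a point of \<open>D \<inter> socle\<close>, but to \<open>n\<close> or \<open>2n\<close> at a point of \<open>D - socle\<close>.\<close>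

lemma card_basic_socle:
  assumes D: "D \<in> S" "D \<noteq> {\<one>}"
  shows "p \<le> 2 * card (D \<inter> socle)"
proof (rule ccontr)
  define n where "n = card (D \<inter> socle)"
  assume "\<not> ?thesis"
  then have n: "2 * n < p" by (simp add: n_def)
  have Dc: "x \<in> carrier G" if "x \<in> D" for x using that D(1) S_carrier by blast
  have finD: "finite D" using S_subset[OF D(1)] fin finite_subset by blast
  have one_D: "\<one> \<notin> D" using S_disjoint[OF D(1) S_one] D(2) by blast
  have inv_socle: "inv u \<in> socle" if "u \<in> socle" for u
    by (rule subgroup.m_inv_closed[OF subgroup_socle that])
  have mult_socle: "u \<otimes> v \<in> socle" if "u \<in> socle" "v \<in> socle" for u v
    by (rule subgroup.m_closed[OF subgroup_socle that])
  have cancel_right: "u \<in> socle" if "v \<in> socle" "u \<otimes> v \<in> socle" "u \<in> carrier G" for u v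
    using mult_socle[OF that(2) inv_socle[OF that(1)]] that by (simp add: m_assoc)
  have basic_mult_socle: "y \<otimes> u \<in> D - socle" if y: "y \<in> D - socle" and u: "u \<in> socle" for y u
  proof -
    have yc: "y \<in> carrier G" using y Dc by blast
    have "(y \<otimes> u \<otimes> inv y) \<otimes> y \<in> D"
      using socle_mult_basic[OF D(1)] y socle_conj[OF yc u] by blast
    then have "y \<otimes> u \<in> D" using yc u by (simp add: m_assoc)
    moreover have "y \<otimes> u \<notin> socle" using cancel_right[OF u _ yc] y by blast
    ultimately show ?thesis by blast
  qed
  obtain g where g: "g \<in> D" "g \<in> socle" using basic_meets_socle[OF D(1)] by blast
  \<comment> \<open>The socle is a proper subgroup, so primitivity allows no nontrivial basic set
    inside it.\<close>
  have "\<not> D \<subseteq> socle"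
  proof
    assume "D \<subseteq> socle"
    then have "D \<subseteq> {\<one>}"
      using A_set_in_proper_subgroup uline_basic[OF D(1)] subgroup_socle socle_proper by blast
    then show False using S_nonempty[OF D(1)] one_D by blast
  qed
  then obtain h where h: "h \<in> D" "h \<notin> socle" by blast
  have gc: "g \<in> carrier G" and hc: "h \<in> carrier G" using g h Dc by auto
  define c where "c x = card {y\<in>D. inv x \<otimes> y \<in> D}" for x
  have "gr_mult G (uline D) (uline (m_inv G ` D)) \<in> zspan S"
    by (intro zspan_mult uline_basic S_inv D(1))
  then have "gr_mult G (uline D) (uline (m_inv G ` D)) g = gr_mult G (uline D) (uline (m_inv G ` D)) h"
    using g(1) h(1) D(1) unfolding zspan_iff by blast
  then have c_eq: "c g = c h"
    unfolding mult_inv_apply[OF D(1) gc] mult_inv_apply[OF D(1) hc] c_def by simp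
  define d where "d = card {y\<in>D \<inter> socle. inv g \<otimes> y \<in> D}"
  \<comment> \<open>The point \<open>y = g\<close> is lost, since \<open>inv g \<otimes> g\<close>
    is the identity, which is not in \<open>D\<close>.\<close>
  have d: "d < n"
    unfolding d_def n_def
  proof (rule psubset_card_mono)
    have "g \<notin> {y\<in>D \<inter> socle. inv g \<otimes> y \<in> D}" using one_D gc by simp
    then show "{y\<in>D \<inter> socle. inv g \<otimes> y \<in> D} \<subset> D \<inter> socle" using g by blast
  qed (use finD in simp)
  \<comment> \<open>Every \<open>y\<close> in \<open>D\<close> outside the socle is counted, because
    \<open>inv g\<close> lies in the socle and keeps \<open>y\<close> in \<open>D\<close>.\<close>
  have "{y\<in>D. inv g \<otimes> y \<in> D} = {y\<in>D \<inter> socle. inv g \<otimes> y \<in> D} \<union> (D - socle)"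
    using socle_mult_basic[OF D(1) _ _ inv_socle[OF g(2)]] by blast
  then have "c g = d + card (D - socle)"
    unfolding c_def d_def by (simp only:) (rule card_Un_disjoint, use finD in auto)
  moreover have "p dvd card (D - socle)"
    by (rule prime_dvd_card_socle_invariant) (use Dc basic_mult_socle in auto)
  ultimately have cg: "[c g = d] (mod p)" by (auto simp: cong_def)
  \<comment> \<open>The \<open>y\<close> counted by \<open>c h\<close> split into those in the socle
    (\<open>U\<close>), those in the coset of \<open>h\<close> by the socle, and the rest
    (\<open>W\<close>). \<open>U\<close> is all of \<open>D \<inter> socle\<close> or empty, the
    second kind numbers \<open>n\<close>, and \<open>W\<close> is closed under the socle.\<close>
  define W where "W = {y \<in> D - socle. inv h \<otimes> y \<in> D - socle}"
  define U where "U = (if inv h \<in> D then D \<inter> socle else {})"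
  have hi: "inv h \<notin> socle" using inv_socle[of "inv h"] h(2) hc by auto
  have hiy: "inv h \<otimes> y \<in> D \<longleftrightarrow> inv h \<in> D" if y: "y \<in> socle" for y
  proof
    assume "inv h \<in> D" then show "inv h \<otimes> y \<in> D" using basic_mult_socle[OF _ y] hi by blast
  next
    assume hy: "inv h \<otimes> y \<in> D"
    have yc: "y \<in> carrier G" using y by simp
    have "inv h \<otimes> y \<notin> socle" using cancel_right[OF y] hi hc by blast
    then have "inv h \<otimes> y \<otimes> inv y \<in> D" using basic_mult_socle[OF _ inv_socle[OF y]] hy by blast
    then show "inv h \<in> D" using hc yc by (simp add: m_assoc)
  qed
  have "{y\<in>D. inv h \<otimes> y \<in> D} = U \<union> ((\<lambda>u. h \<otimes> u) ` (D \<inter> socle) \<union> W)"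
  proof (intro equalityI subsetI)
    fix y assume y: "y \<in> {y\<in>D. inv h \<otimes> y \<in> D}"
    show "y \<in> U \<union> ((\<lambda>u. h \<otimes> u) ` (D \<inter> socle) \<union> W)"
    proof (cases "y \<in> socle")
      case True
      then show ?thesis using y hiy by (simp add: U_def)
    next
      case False
      show ?thesis
      proof (cases "inv h \<otimes> y \<in> socle")
        case True
        moreover have "y = h \<otimes> (inv h \<otimes> y)" using hc y Dc by simp
        ultimately show ?thesis using y by blast
      qed (use y False in \<open>simp add: W_def\<close>)
    qed
  next
    fix y assume "y \<in> U \<union> ((\<lambda>u. h \<otimes> u) ` (D \<inter> socle) \<union> W)"
    then consider "y \<in> U" | u where "u \<in> D" "u \<in> socle" "y = h \<otimes> u" | "y \<in> W" by blast
    then show "y \<in> {y\<in>D. inv h \<otimes> y \<in> D}"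
    proof cases
      case 1
      then show ?thesis using hiy by (auto simp: U_def split: if_splits)
    next
      case 2
      then show ?thesis using basic_mult_socle[of h u] h hc by auto
    qed (simp add: W_def)
  qed
  moreover have "h \<otimes> u \<notin> socle" if "u \<in> socle" for u
    using cancel_right[OF that _ hc] h(2) by blast
  moreover have "inv h \<otimes> (h \<otimes> u) \<in> socle" if "u \<in> socle" for u
    using that hc by simp
  ultimately have "c h = card U + (card ((\<lambda>u. h \<otimes> u) ` (D \<inter> socle)) + card W)"
    unfolding c_def
    by (simp only:) (subst card_Un_disjoint card_Un_disjoint; use finD in \<open>auto simp: U_def W_def\<close>)+
  moreover have "card ((\<lambda>u. h \<otimes> u) ` (D \<inter> socle)) = n"
    unfolding n_def by (rule card_image) (use hc Dc in \<open>auto intro!: inj_onI\<close>)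
  moreover have "p dvd card W"
  proof (rule prime_dvd_card_socle_invariant)
    show "W \<subseteq> carrier G" using Dc by (auto simp: W_def)
    fix y u assume yu: "y \<in> W" "u \<in> socle"
    then have "inv h \<otimes> (y \<otimes> u) = inv h \<otimes> y \<otimes> u" using Dc hc by (simp add: W_def m_assoc)
    then show "y \<otimes> u \<in> W" using yu basic_mult_socle by (simp add: W_def)
  qed
  ultimately have "c h = card U + n + card W" "[card U + n + card W = card U + n + 0] (mod p)"
    by (simp, intro cong_add cong_refl) (simp add: cong_0_iff)
  then have ch: "[c h = card U + n] (mod p)" by simp
  have "card U \<le> n" by (simp add: U_def n_def)
  \<comment> \<open>\<open>2 * n < p\<close> keeps both sides below \<open>p\<close>, so the
    congruence becomes an equality, against \<open>d < n\<close>.\<close>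
  then have "[d = card U + n] (mod p)" "card U + n < p" "d < p"
    using cg ch c_eq n d by (auto intro: cong_trans cong_sym)
  then have "d = card U + n" by (simp add: cong_less_modulus_unique_nat)
  then show False using d by simp
qed

section \<open>Collapse to the trivial S-ring\<close>

lemma basic_unique:
  assumes D: "D \<in> S" "D \<noteq> {\<one>}" and E: "E \<in> S" "E \<noteq> {\<one>}"
  shows "D = E"
proof (rule ccontr)
  assume "D \<noteq> E"
  then have disj: "(D \<inter> socle) \<inter> (E \<inter> socle) = {}" using S_disjoint[OF D(1) E(1)] by blast
  have "\<one> \<notin> D" "\<one> \<notin> E" using S_disjoint[OF _ S_one] D E by blast+
  \<comment> \<open>The identity is in the socle but in neither set, so the two intersections
    together have fewer than \<open>p\<close> elements, although each has at least half of
    \<open>p\<close>.\<close>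
  then have "(D \<inter> socle) \<union> (E \<inter> socle) \<subset> socle" using one_in_socle by blast
  then have "card ((D \<inter> socle) \<union> (E \<inter> socle)) < p"
    using psubset_card_mono[OF finite_socle] card_socle by metis
  then have "card (D \<inter> socle) + card (E \<inter> socle) < p"
    using card_Un_disjoint[OF _ _ disj] finite_socle by simp
  then show False using card_basic_socle[OF D] card_basic_socle[OF E] by simp
qed

lemma zspan_trivial: "zspan S = trivial_sring G"
proof (intro equalityI subsetI)
  fix f assume f: "f \<in> zspan S"
  \<comment> \<open>\<open>c\<close> is the constant value on the single basic set other than
    \<open>{\<one>}\<close>; for a one-element carrier the claim is vacuous.\<close>
  obtain c where c: "f x = c" if "x \<in> carrier G" "x \<noteq> \<one>" for x
  proof (cases "\<exists>x\<in>carrier G. x \<noteq> \<one>")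
    case True
    then obtain x where x: "x \<in> carrier G" "x \<noteq> \<one>" by blast
    have "f y = f x" if y: "y \<in> carrier G" "y \<noteq> \<one>" for y
    proof -
      obtain D E where "D \<in> S" "x \<in> D" "E \<in> S" "y \<in> E" using x y S_Union by blast
      moreover from this have "D = E" using basic_unique x y by blast
      ultimately show ?thesis using f unfolding zspan_iff by blast
    qed
    then show thesis using that by blast
  qed (use that in blast)
  have "f = (\<lambda>x. (f \<one> - c) * uline {\<one>} x + c * uline (carrier G) x)"
  proof
    fix x
    have "f x = 0" if "x \<notin> carrier G" using f that unfolding zspan_iff by blast
    then show "f x = (f \<one> - c) * uline {\<one>} x + c * uline (carrier G) x"
      using c[of x] by (cases "x \<in> carrier G"; cases "x = \<one>") (simp_all add: uline_def)
  qed
  then show "f \<in> trivial_sring G" unfolding trivial_sring_def by blast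
next
  fix f assume "f \<in> trivial_sring G"
  then obtain a b where f: "f = (\<lambda>x. a * uline {\<one>} x + b * uline (carrier G) x)"
    by (auto simp: trivial_sring_def)
  show "f \<in> zspan S"
    unfolding zspan_iff
  proof (intro conjI allI impI ballI)
    show "f x = 0" if "x \<notin> carrier G" for x using that by (auto simp: f uline_def)
    fix D x y assume D: "D \<in> S" "x \<in> D" "y \<in> D"
    then have "x \<in> carrier G" "y \<in> carrier G" using S_carrier by blast+
    moreover have "x = \<one> \<longleftrightarrow> y = \<one>" using S_disjoint[OF D(1) S_one] D by blast
    ultimately show "f x = f y" by (cases "x = \<one>") (simp_all add: f uline_def)
  qed
qed

end

section \<open>Application to the given S-ring\<close>

theorem theorem1p3:
  fixes G :: "('a, 'b) monoid_scheme" and A :: "('a \<Rightarrow> int) set" and p :: nat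
  assumes "group G" and "finite (carrier G)"
    and "order G > 1" and "\<not> Factorial_Ring.prime (order G)"
    and "Factorial_Ring.prime p" and "p dvd order G"
    and "\<exists>P. subgroup P G \<and> card P = p ^ Factorial_Ring.multiplicity p (order G) \<and> P \<lhd> G
             \<and> cyclic_group (G\<lparr>carrier := P\<rparr>)"
    and "is_schur_ring G A"
    and "central_sring G A"
    and "A \<noteq> trivial_sring G"
  shows "\<not> primitive_sring G A"
proof
  assume prim: "primitive_sring G A"
  interpret group G by fact
  define k where "k = Factorial_Ring.multiplicity p (order G)"
  obtain P where P: "subgroup P G" "card P = p ^ k" "P \<lhd> G" "cyclic_group (G\<lparr>carrier := P\<rparr>)"
    using assms(7) by (auto simp: k_def)
  obtain w where w: "w \<in> P" "P = range (\<lambda>n::int. w [^]\<^bsub>G\<lparr>carrier := P\<rparr>\<^esub> n)"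
    using group.cyclic_group[OF subgroup_imp_group[OF P(1)]] P(4) by auto
  \<comment> \<open>Cyclicity is stated in the subgroup as a group of its own; its powers of
    \<open>w\<close> agree with those in \<open>G\<close>.\<close>
  have w_pow: "w [^]\<^bsub>G\<lparr>carrier := P\<rparr>\<^esub> n = w [^]\<^bsub>G\<^esub> n" for n :: int
    using int_pow_consistent[OF P(1) w(1)] by simp
  have order_nz: "order G \<noteq> 0" "\<not> is_unit p"
    using assms(3,5) by (auto simp: not_prime_unit)
  obtain S where S: "is_schur_partition G S" "A = zspan S"
    using assms(8) by (auto simp: is_schur_ring_def)
  interpret schur_partition G S by unfold_locales (use assms(2) S(1) in auto)
  interpret normal P G by fact
  \<comment> \<open>Assumed primitivity supplies the last locale hypothesis, and
    \<open>zspan_trivial\<close> then contradicts the nontriviality of \<open>A\<close>.\<close>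
  interpret central_primitive_sring G p k P w S
  proof unfold_locales
    show "w \<in> carrier G" using w(1) P(1) subgroup.subset by blast
    show "P = range (\<lambda>i::int. w [^]\<^bsub>G\<^esub> i)" using w(2) by (simp only: w_pow)
    show "k > 0" unfolding k_def using order_nz assms(5,6) by (simp add: prime_multiplicity_gt_zero_iff)
    have "\<not> p dvd order G div p ^ k"
      unfolding k_def using multiplicity_decompose[OF order_nz] by simp
    then show "coprime p (order G div card P)" using assms(5) P(2) by (simp add: prime_imp_coprime)
    show "H = {\<one>\<^bsub>G\<^esub>} \<or> H = carrier G" if "subgroup H G" "uline H \<in> zspan S" for H
      using prim that A_set_iff by (auto simp: primitive_sring_def A_subgroup_def S(2))
  qed (use assms(2,4,5,9) P(2) S in simp_all)
  show False using zspan_trivial assms(10) S(2) by simp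
qed

end
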